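(* Let $k\ge1$ and let $\mu_k$ be an LTI probability measure on $X_k=\{0,1\}^{\{0,\ldots,k\}}$. Then the total entropy attains its minimum over the set of translation invariant probability measures on $\{0,1\}^{\mathbb{Z}}$ with marginal $\mu_k$ on $X_k$, and some minimizer has the form $$\hat\mu=\sum_{i=0}^{2^k}c_i\,\nu_{{\cal C}_i},\qquad c_i\ge0,\quad\sum_{i=0}^{2^k}c_i=1,$$ for some cycles ${\cal C}_0,\ldots,{\cal C}_{2^k}$ of the de Bruijn graph $G_k$.
   Context: Total entropy of a translation invariant measure $\mu$: $S(\mu)=\lim_{j\to\infty}S(\pi_j\mu)$, where $\pi_j\mu$ is the marginal on coordinates $0,\ldots,j$ and $S$ is the Gibbs–Shannon entropy. LTI: for all $A,A'\subset\{0,\ldots,k\}$ with $A'$ a translate of $A$, the marginal on $\{0,1\}^{A'}$ is the translate of the marginal on $\{0,1\}^A$. The de Bruijn graph $G_k$: vertices are binary strings of length $k$, edges are binary strings of length $k+1$, edge $a\theta b$ runs from $a\theta$ to $\theta b$. A cycle is a closed directed path with no repeated vertex (loops included). For a cycle ${\cal C}$ with edges $\eta^{(1)},\ldots,\eta^{(p)}$ in order, $\nu_{\cal C}$ is the measure giving mass $1/p$ to each of the $p$ translates of the periodic configuration obtained by traversing ${\cal C}$ repeatedly and recording the first symbol of each edge. *)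

theory Defs
  imports "HOL-Probability.Probability"
begin

definition Omega :: "(int \<Rightarrow> bool) measure" where
  "Omega = PiM UNIV (\<lambda>_. count_space (UNIV :: bool set))"

definition shift :: "(int \<Rightarrow> bool) \<Rightarrow> (int \<Rightarrow> bool)" where
  "shift x = (\<lambda>i. x (i + 1))"

definition translation_invariant_prob :: "(int \<Rightarrow> bool) measure \<Rightarrow> bool" where
  "translation_invariant_prob \<mu> \<longleftrightarrow>
     prob_space \<mu> \<and> sets \<mu> = sets Omega \<and> distr \<mu> Omega shift = \<mu>"

definition marg :: "nat \<Rightarrow> (int \<Rightarrow> bool) measure \<Rightarrow> bool list measure" where
  "marg j \<mu> = distr \<mu> (count_space UNIV) (\<lambda>x. map x [0..int j])"

text \<open>Gibbs-Shannon entropy of the marginal on 0..j (natural logarithm; 0 ln 0 = 0).\<close>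
definition marg_entropy :: "nat \<Rightarrow> (int \<Rightarrow> bool) measure \<Rightarrow> real" where
  "marg_entropy j \<mu> =
     - (\<Sum>xs\<in>{xs :: bool list. length xs = Suc j}.
          measure (marg j \<mu>) {xs} * ln (measure (marg j \<mu>) {xs}))"

text \<open>Total entropy: the (monotone, extended-real) limit of the marginal entropies.\<close>
definition total_entropy :: "(int \<Rightarrow> bool) measure \<Rightarrow> ereal" where
  "total_entropy \<mu> = lim (\<lambda>j. ereal (marg_entropy j \<mu>))"

text \<open>LTI probability measure on X_k = {0,1}^{0..k}, represented as a pmf on
  binary strings of length k+1 (position i of the string = coordinate i).\<close>
definition LTI :: "nat \<Rightarrow> bool list pmf \<Rightarrow> bool" where
  "LTI k \<mu>k \<longleftrightarrow>
     set_pmf \<mu>k \<subseteq> {xs. length xs = Suc k} \<and>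
     (\<forall>A t. A \<subseteq> {0..k} \<longrightarrow> (\<lambda>i. i + t) ` A \<subseteq> {0..k} \<longrightarrow>
        map_pmf (\<lambda>xs. restrict (\<lambda>i. xs ! i) ((\<lambda>i. i + t) ` A)) \<mu>k =
        map_pmf (\<lambda>xs. restrict (\<lambda>i. xs ! (i - t)) ((\<lambda>i. i + t) ` A)) \<mu>k)"

text \<open>A cycle of the de Bruijn graph G_k, given by its list of edges
  (strings of length k+1) in order; edge a theta b runs from a theta (= butlast)
  to theta b (= tl). No repeated vertex; loops allowed.\<close>
definition debruijn_cycle :: "nat \<Rightarrow> bool list list \<Rightarrow> bool" where
  "debruijn_cycle k es \<longleftrightarrow>
     es \<noteq> [] \<and> (\<forall>e\<in>set es. length e = Suc k) \<and>
     (\<forall>i<length es. tl (es ! i) = butlast (es ! ((i + 1) mod length es))) \<and>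
     distinct (map butlast es)"

definition cycle_config :: "bool list list \<Rightarrow> int \<Rightarrow> (int \<Rightarrow> bool)" where
  "cycle_config es s = (\<lambda>n. hd (es ! nat ((n + s) mod int (length es))))"

definition nu_cycle :: "bool list list \<Rightarrow> (int \<Rightarrow> bool) measure" where
  "nu_cycle es =
     distr (measure_pmf (map_pmf (cycle_config es) (pmf_of_set {0..<int (length es)}))) Omega id"

end

theory Submission
  imports Defs
begin

text \<open>
  Giving each atom of a cycle \<open>C\<close> the mass \<open>a C\<close>, the mixtures of cycle measures with
  marginal \<open>\<mu>k\<close> correspond to the decompositions of the circulation \<open>\<mu>k\<close> into cycles, and the
  entropy of such a mixture is at most the concave function
  \<open>cost a = (\<Sum>C. length C * eta (a C))\<close>, where \<open>eta t = - t * ln t\<close>. A concave function on this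
  polytope is minimized at a basic solution; circulations form a space of dimension
  \<open>2 ^ k + 1\<close>, so a basic solution uses at most that many cycles. Equality
  of entropy and cost is not needed, since any translation invariant measure of finite entropy
  \<open>r\<close> with marginal \<open>\<mu>k\<close> yields a decomposition of cost at most \<open>r\<close>: it is
  carried by points of positive mass \<open>m\<close>, whose orbits are finite; each orbit is an integer
  circulation, hence a sum of cycles with integer multiplicities, and replacing the orbit by these
  cycles keeps the mass \<open>m\<close> of each atom, while merging equal cycles only
  decreases the entropy.
\<close>

subsection \<open>Circulations on the de Bruijn graph\<close>

text \<open>The \<open>2 ^ (k + 1)\<close> edges are subject to one conservation law for each of the
  \<open>2 ^ k\<close> vertices, and these laws add up to a trivial identity. This is the origin of
  the dimension \<open>2 ^ k + 1\<close>.

  Attainment comes from finiteness: every feasible point is dominated by a basic one, and a basic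
  one is determined by its support, a subset of a finite set.

  An element of \<open>cycles k\<close> is a list, so a geometric cycle occurs once for each
  starting edge. Rotations have the same edge set and the same cycle measure, and a point that
  spreads mass over several of them has a cost above the entropy of its mixture. In a basic solution
  two rotations cannot occur together.

  Integrality is the crux of the lower bound: a cycle that occurs in an orbit occurs there at least
  once, so each of its atoms receives at least the mass of a point of the orbit and carries no more
  information than that point.\<close>

definition edges :: "nat \<Rightarrow> bool list set" where
  "edges k = {e. length e = Suc k}"

text \<open>Conservation is asked at every list \<open>v\<close>; both sums vanish unless
  \<open>length v = k\<close>. The indicators keep the law visibly linear in
  \<open>f\<close>.\<close>

definition circulation :: "nat \<Rightarrow> (bool list \<Rightarrow> real) \<Rightarrow> bool" where
  "circulation k f \<longleftrightarrow>
     (\<forall>v. (\<Sum>e\<in>edges k. f e * of_bool (tl e = v)) = (\<Sum>e\<in>edges k. f e * of_bool (butlast e = v)))"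

definition cycles :: "nat \<Rightarrow> bool list list set" where
  "cycles k = {es. debruijn_cycle k es}"

lemma finite_bool_lists: "finite {xs :: bool list. length xs = n}"
  using finite_lists_length_eq[of "UNIV :: bool set" n] by simp

lemma card_bool_lists: "card {xs :: bool list. length xs = n} = 2 ^ n"
  using card_lists_length_eq[of "UNIV :: bool set" n] by simp

lemma finite_edges [simp]: "finite (edges k)"
  unfolding edges_def by (rule finite_bool_lists)

lemma edges_tl_eq:
  assumes "length v = k" shows "{e \<in> edges k. tl e = v} = {True # v, False # v}"
proof (intro set_eqI iffI)
  fix e assume "e \<in> {e \<in> edges k. tl e = v}"
  then show "e \<in> {True # v, False # v}" by (cases e; cases "hd e") (auto simp: edges_def)
qed (use assms in \<open>auto simp: edges_def\<close>)

lemma edges_butlast_eq: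
  assumes "length v = k" shows "{e \<in> edges k. butlast e = v} = {v @ [True], v @ [False]}"
proof (intro set_eqI iffI)
  fix e assume "e \<in> {e \<in> edges k. butlast e = v}"
  then show "e \<in> {v @ [True], v @ [False]}"
    by (cases e rule: rev_cases; cases "last e") (auto simp: edges_def)
qed (use assms in \<open>auto simp: edges_def\<close>)

lemma sum_of_bool_Collect:
  fixes f :: "'a \<Rightarrow> real"
  assumes "finite A"
  shows "(\<Sum>e\<in>A. f e * of_bool (P e)) = sum f {e \<in> A. P e}"
proof -
  have "sum f {e \<in> A. P e} = (\<Sum>e\<in>A. if P e then f e else 0)"
    using assms by (rule sum.inter_filter)
  also have "\<dots> = (\<Sum>e\<in>A. f e * of_bool (P e))" by (rule sum.cong) auto
  finally show ?thesis by simp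
qed

lemma circulationD:
  assumes "circulation k f" "length v = k"
  shows "f (True # v) + f (False # v) = f (v @ [True]) + f (v @ [False])"
proof -
  have "sum f {e \<in> edges k. tl e = v} = sum f {e \<in> edges k. butlast e = v}"
    using assms(1)[unfolded circulation_def, THEN spec, of v]
    by (simp only: sum_of_bool_Collect[OF finite_edges])
  then show ?thesis using assms(2) by (simp add: edges_tl_eq edges_butlast_eq)
qed

lemma circulation_diff:
  assumes "circulation k f" "circulation k g"
  shows "circulation k (\<lambda>e. f e - t * g e)"
  using assms unfolding circulation_def
  by (simp add: left_diff_distrib sum_subtractf mult.assoc sum_distrib_left[symmetric])

lemma circulation_sum:
  assumes "\<And>i. i \<in> I \<Longrightarrow> circulation k (g i)"
  shows "circulation k (\<lambda>e. \<Sum>i\<in>I. d i * g i e)"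
proof -
  have "(\<Sum>e\<in>edges k. (\<Sum>i\<in>I. d i * g i e) * of_bool (Q e))
      = (\<Sum>i\<in>I. d i * (\<Sum>e\<in>edges k. g i e * of_bool (Q e)))" for Q
    unfolding sum_distrib_right sum_distrib_left mult.assoc by (rule sum.swap)
  then show ?thesis using assms unfolding circulation_def by simp
qed

lemma finite_cycles [simp]: "finite (cycles k)"
proof (rule finite_subset)
  show "cycles k \<subseteq> {es. set es \<subseteq> edges k \<and> distinct es}"
    by (auto simp: cycles_def debruijn_cycle_def edges_def distinct_map)
qed (rule finite_subset_distinct, simp)

lemma cyclesD:
  assumes "C \<in> cycles k"
  shows "C \<noteq> []" "set C \<subseteq> edges k" "distinct C" "0 < length C"
    "\<And>i. i < length C \<Longrightarrow> tl (C ! i) = butlast (C ! ((i + 1) mod length C))"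
  using assms by (auto simp: cycles_def debruijn_cycle_def edges_def distinct_map)

lemma bij_betw_Suc_mod:
  assumes "0 < (p::nat)" shows "bij_betw (\<lambda>i. (i + 1) mod p) {..<p} {..<p}"
proof -
  have "inj_on (\<lambda>i. (i + 1) mod p) {..<p}"
    by (auto simp: inj_on_def mod_Suc split: if_splits)
  moreover have "(\<lambda>i. (i + 1) mod p) ` {..<p} \<subseteq> {..<p}" using assms by auto
  ultimately show ?thesis by (simp add: bij_betw_def endo_inj_surj)
qed

lemma sum_of_bool_mem:
  fixes g :: "'a \<Rightarrow> real"
  assumes "finite A" "set xs \<subseteq> A" "distinct xs"
  shows "(\<Sum>e\<in>A. of_bool (e \<in> set xs) * g e) = (\<Sum>i<length xs. g (xs ! i))"
proof -
  have "(\<Sum>e\<in>A. of_bool (e \<in> set xs) * g e) = sum g {e\<in>A. e \<in> set xs}"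
    using sum_of_bool_Collect[OF assms(1), of g] by (simp add: mult.commute)
  also have "{e\<in>A. e \<in> set xs} = set xs" using assms by auto
  also have "sum g (set xs) = (\<Sum>i<length xs. g (xs ! i))"
    by (rule sum.reindex_bij_betw[OF bij_betw_nth, symmetric]) (use assms in auto)
  finally show ?thesis .
qed

lemma sum_of_bool_cycle:
  assumes "C \<in> cycles k"
  shows "(\<Sum>e\<in>edges k. of_bool (e \<in> set C)) = real (length C)"
  using sum_of_bool_mem[of "edges k" C "\<lambda>_. 1"] cyclesD[OF assms] by simp

text \<open>Passing to the next position permutes the indices and matches the end vertex of each
  edge with the start vertex of its successor.\<close>

lemma circulation_cycle:
  assumes "C \<in> cycles k" shows "circulation k (\<lambda>e. of_bool (e \<in> set C))"
  unfolding circulation_def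
proof
  fix v
  note C = cyclesD[OF assms]
  have "(\<Sum>i<length C. of_bool (tl (C ! i) = v))
      = (\<Sum>i<length C. of_bool (butlast (C ! ((i + 1) mod length C)) = v) :: real)"
    using C(5) by (intro sum.cong) auto
  also have "\<dots> = (\<Sum>i<length C. of_bool (butlast (C ! i) = v))"
    by (rule sum.reindex_bij_betw[OF bij_betw_Suc_mod[OF C(4)]])
  finally show "(\<Sum>e\<in>edges k. of_bool (e \<in> set C) * of_bool (tl e = v))
      = (\<Sum>e\<in>edges k. of_bool (e \<in> set C) * of_bool (butlast e = v) :: real)"
    unfolding sum_of_bool_mem[OF finite_edges C(2,3)] .
qed

text \<open>By conservation, a vertex entered by a positive edge is also left by one, so a walk
  along positive edges never stops and must revisit a vertex.\<close>

lemma ex_cycle_in_support: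
  assumes circ: "circulation k f" and nonneg: "\<And>e. 0 \<le> f e"
    and e0: "e0 \<in> edges k" "0 < f e0"
  obtains C where "C \<in> cycles k" "\<And>e. e \<in> set C \<Longrightarrow> 0 < f e"
proof -
  let ?S = "{e \<in> edges k. 0 < f e}"
  have ex: "\<exists>e'. e' \<in> ?S \<and> tl e = butlast e'" if "e \<in> ?S" for e
  proof -
    have "0 < sum f {e' \<in> edges k. tl e' = tl e}"
      by (rule sum_pos2[of _ e]) (use that nonneg in auto)
    also have "\<dots> = sum f {e' \<in> edges k. butlast e' = tl e}"
      using circ[unfolded circulation_def, THEN spec, of "tl e"]
      by (simp only: sum_of_bool_Collect[OF finite_edges])
    finally have "\<not> (\<forall>e'\<in>{e' \<in> edges k. butlast e' = tl e}. f e' \<le> 0)"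
      by (meson not_le sum_nonpos)
    then show ?thesis by auto
  qed
  define nx where "nx e = (SOME e'. e' \<in> ?S \<and> tl e = butlast e')" for e
  have nx: "nx e \<in> ?S" "tl e = butlast (nx e)" if "e \<in> ?S" for e
    using someI_ex[OF ex[OF that]] unfolding nx_def by auto
  define s where "s n = (nx ^^ n) e0" for n
  have s: "s n \<in> ?S" for n
    by (induction n) (use e0 nx in \<open>auto simp: s_def\<close>)
  have step: "tl (s n) = butlast (s (Suc n))" for n
    using nx(2)[OF s[of n]] by (simp add: s_def)
  \<comment> \<open>\<open>Q d\<close> says that some vertex of the walk recurs after
    \<open>d\<close> steps. For the least such \<open>d\<close> the vertices of the closed piece are
    distinct, since a repetition inside it would have a smaller gap.\<close>
  define Q where "Q d \<longleftrightarrow> 0 < d \<and> (\<exists>i. butlast (s i) = butlast (s (i + d)))" for d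
  have "\<exists>d. Q d"
  proof -
    have "finite (range (\<lambda>n. butlast (s n)))"
      by (rule finite_subset[of _ "butlast ` edges k"]) (use s in auto)
    then have "\<not> inj (\<lambda>n. butlast (s n))"
      using finite_imageD infinite_UNIV_nat by blast
    then obtain i j where "butlast (s i) = butlast (s j)" "i < j"
      by (auto simp: inj_on_def) (metis linorder_neqE_nat)
    then have "Q (j - i)" unfolding Q_def by (auto intro!: exI[of _ i])
    then show ?thesis ..
  qed
  then have "Q (LEAST d. Q d)" by (rule LeastI_ex)
  then obtain d i where d: "d = (LEAST d. Q d)" "0 < d" "butlast (s i) = butlast (s (i + d))"
    unfolding Q_def by blast
  have least: "\<not> Q d'" if "d' < d" for d' using that d(1) not_less_Least by blast
  define C where "C = map (\<lambda>n. s (i + n)) [0..<d]"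
  have "debruijn_cycle k C"
    unfolding debruijn_cycle_def
  proof (intro conjI ballI allI impI)
    show "C \<noteq> []" using d by (simp add: C_def)
    show "length e = Suc k" if "e \<in> set C" for e
      using that s by (auto simp: C_def edges_def)
    show "tl (C ! n) = butlast (C ! ((n + 1) mod length C))" if "n < length C" for n
    proof (cases "Suc n = d")
      case True
      then show ?thesis using that d(2,3) step[of "i + n"] by (auto simp: C_def)
    next
      case False
      then show ?thesis using that step[of "i + n"] by (simp add: C_def)
    qed
    have "butlast (s (i + m)) \<noteq> butlast (s (i + n))" if "m < n" "n < d" for m n
    proof
      assume "butlast (s (i + m)) = butlast (s (i + n))"
      then have "Q (n - m)" unfolding Q_def using that by (auto intro!: exI[of _ "i + m"])
      then show False using least[of "n - m"] that by simp
    qed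
    then have "inj_on (\<lambda>n. butlast (s (i + n))) {..<d}"
      by (intro linorder_inj_onI) auto
    then show "distinct (map butlast C)"
      by (simp add: C_def distinct_map comp_def atLeast0LessThan)
  qed
  moreover have "0 < f e" if "e \<in> set C" for e
    using that s by (auto simp: C_def)
  ultimately show thesis using that by (auto simp: cycles_def)
qed

text \<open>Subtracting the smallest value of \<open>f\<close> along a cycle in its support keeps \<open>f\<close> a
  nonnegative circulation, shrinks the support, and keeps integer values integer.\<close>

lemma circulation_decomposition:
  assumes "circulation k f" "\<And>e. 0 \<le> f e" "\<And>e. e \<notin> edges k \<Longrightarrow> f e = 0"
  shows "\<exists>a. (\<forall>C. 0 \<le> a C) \<and> (\<forall>e. f e = (\<Sum>C\<in>cycles k. a C * of_bool (e \<in> set C))) \<and>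
           (range f \<subseteq> \<int> \<longrightarrow> range a \<subseteq> \<int>)"
  using assms
proof (induction "card {e \<in> edges k. f e \<noteq> 0}" arbitrary: f rule: less_induct)
  case less
  show ?case
  proof (cases "\<exists>e\<in>edges k. f e \<noteq> 0")
    case False
    then have "f e = 0" for e using less.prems(3) by blast
    then show ?thesis by (intro exI[of _ "\<lambda>_. 0"]) auto
  next
    case True
    then obtain e0 where "e0 \<in> edges k" "0 < f e0"
      using less.prems(2) by (metis order_less_le)
    then obtain C where C: "C \<in> cycles k" and pos: "\<And>e. e \<in> set C \<Longrightarrow> 0 < f e"
      using ex_cycle_in_support less.prems by metis
    define t where "t = Min (f ` set C)"
    have "t \<in> f ` set C" unfolding t_def using cyclesD(1)[OF C] by (intro Min_in) auto
    then obtain e1 where e1: "e1 \<in> set C" "t = f e1" by auto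
    have t_le: "t \<le> f e" if "e \<in> set C" for e unfolding t_def using that by simp
    have t0: "0 < t" using pos e1 by simp
    define g where "g e = f e - t * of_bool (e \<in> set C)" for e
    have g: "circulation k g" unfolding g_def
      using less.prems(1) circulation_cycle[OF C] by (rule circulation_diff)
    have g0: "0 \<le> g e" for e using t_le less.prems(2) by (cases "e \<in> set C") (auto simp: g_def)
    have gE: "g e = 0" if "e \<notin> edges k" for e
      using that less.prems(3) cyclesD(2)[OF C] by (auto simp: g_def)
    have e1E: "e1 \<in> edges k" using e1 cyclesD(2)[OF C] by auto
    have "{e \<in> edges k. g e \<noteq> 0} \<subset> {e \<in> edges k. f e \<noteq> 0}"
    proof
      show "{e \<in> edges k. g e \<noteq> 0} \<subseteq> {e \<in> edges k. f e \<noteq> 0}"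
        using pos by (fastforce simp: g_def)
      have "g e1 = 0" "f e1 \<noteq> 0" using e1 t0 by (auto simp: g_def)
      then show "{e \<in> edges k. g e \<noteq> 0} \<noteq> {e \<in> edges k. f e \<noteq> 0}" using e1E by blast
    qed
    then have "card {e \<in> edges k. g e \<noteq> 0} < card {e \<in> edges k. f e \<noteq> 0}"
      by (intro psubset_card_mono) auto
    from less.hyps[OF this g g0 gE] obtain a where a: "\<And>C. 0 \<le> a C"
      "\<And>e. g e = (\<Sum>C\<in>cycles k. a C * of_bool (e \<in> set C))"
      "range g \<subseteq> \<int> \<Longrightarrow> range a \<subseteq> \<int>" by metis
    define b where "b D = a D + t * of_bool (D = C)" for D
    have "f e = (\<Sum>D\<in>cycles k. b D * of_bool (e \<in> set D))" for e
    proof -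
      have "(\<Sum>D\<in>cycles k. b D * of_bool (e \<in> set D))
          = g e + (\<Sum>D\<in>cycles k. if D = C then t * of_bool (e \<in> set D) else 0)"
        unfolding b_def a(2) sum.distrib[symmetric] by (rule sum.cong) (auto simp: algebra_simps)
      also have "\<dots> = g e + t * of_bool (e \<in> set C)" using C by (simp add: sum.delta)
      finally show ?thesis by (simp add: g_def)
    qed
    moreover have "range b \<subseteq> \<int>" if "range f \<subseteq> \<int>"
    proof -
      have "t \<in> \<int>" using that e1 by auto
      moreover then have "range g \<subseteq> \<int>" using that by (auto simp: g_def intro!: Ints_diff Ints_mult)
      ultimately show ?thesis using a(3) by (auto simp: b_def intro!: Ints_add Ints_mult)
    qed
    ultimately show ?thesis using a(1) t0 by (intro exI[of _ b]) (auto simp: b_def)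
  qed
qed

section \<open>Dimension count for circulations\<close>

lemma replicate_False_if: "True \<notin> set w \<Longrightarrow> replicate (length w) False = w"
  by (induction w) auto

text \<open>The edges ending in \<open>False\<close> other than the loop form a tree directed towards
  the all-\<open>False\<close> vertex, so a circulation is determined by its values elsewhere.\<close>

lemma circulation_eq_0:
  assumes circ: "circulation k f"
    and T: "\<And>e. e \<in> edges k \<Longrightarrow> last e \<Longrightarrow> f e = 0"
    and F: "f (replicate (Suc k) False) = 0"
    and e: "e \<in> edges k"
  shows "f e = 0"
proof -
  \<comment> \<open>Induction on the number of trailing \<open>False\<close>: at the start vertex of
    the edge, both incoming edges have one trailing \<open>False\<close> less, and the other
    outgoing edge ends in \<open>True\<close>.\<close>
  have *: "f (u @ True # replicate j False) = 0" if "length u + j = k" for u j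
    using that
  proof (induction j arbitrary: u)
    case 0
    then show ?case by (intro T) (auto simp: edges_def)
  next
    case (Suc j)
    let ?v = "u @ True # replicate j False"
    have l: "length ?v = k" using Suc.prems by simp
    have "f (b # ?v) = 0" for b using Suc.IH[of "b # u"] Suc.prems by simp
    then have "f (?v @ [True]) + f (?v @ [False]) = 0"
      using circulationD[OF circ l] by simp
    moreover have "f (?v @ [True]) = 0" using l by (intro T) (auto simp: edges_def)
    ultimately show ?case by (simp add: replicate_append_same)
  qed
  show ?thesis
  proof (cases "True \<in> set e")
    case True
    then obtain u w where uw: "e = u @ True # w" "True \<notin> set w"
      by (metis split_list_last)
    have "replicate (length w) False = w" using uw(2) by (rule replicate_False_if)
    then show ?thesis using *[of u "length w"] uw(1) e by (simp add: edges_def)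
  next
    case False
    have "replicate (length e) False = e" using False by (rule replicate_False_if)
    then show ?thesis using F e by (simp add: edges_def)
  qed
qed

text \<open>Gaussian elimination, one equation and one unknown at a time; in the vectors
  \<open>u c\<close> the coordinate \<open>i\<close> has been cleared by the pivot
  \<open>p\<close>.\<close>

lemma homogeneous_system:
  fixes v :: "'c \<Rightarrow> 'e \<Rightarrow> real"
  assumes "finite I" "finite T" "card I < card T"
  shows "\<exists>d. (\<exists>c\<in>T. d c \<noteq> 0) \<and> (\<forall>e\<in>I. (\<Sum>c\<in>T. d c * v c e) = 0)"
  using assms
proof (induction I arbitrary: T v rule: finite_induct)
  case empty
  then obtain c where "c \<in> T" by (metis card_gt_0_iff ex_in_conv card.empty)
  then show ?case by (intro exI[of _ "\<lambda>_. 1"]) auto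
next
  case (insert i I)
  show ?case
  proof (cases "\<forall>c\<in>T. v c i = 0")
    case True
    moreover have "card I < card T" using insert by simp
    ultimately show ?thesis using insert.IH[of T v] insert.prems by auto
  next
    case False
    then obtain p where p: "p \<in> T" "v p i \<noteq> 0" by blast
    define u where "u c e = v c e - v c i / v p i * v p e" for c e
    have "card I < card (T - {p})" using insert p by simp
    then obtain d where d: "\<exists>c\<in>T - {p}. d c \<noteq> 0" "\<And>e. e \<in> I \<Longrightarrow> (\<Sum>c\<in>T - {p}. d c * u c e) = 0"
      using insert.IH[of "T - {p}" u] insert.prems by auto
    \<comment> \<open>The value at \<open>p\<close> is the one that turns the sums of
      \<open>u\<close> over \<open>T - {p}\<close> back into the sums of \<open>v\<close> over
      \<open>T\<close>.\<close>
    define d' where "d' = d(p := - (\<Sum>c\<in>T - {p}. d c * v c i) / v p i)"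
    have split: "(\<Sum>c\<in>T. d' c * v c e) = (\<Sum>c\<in>T - {p}. d c * u c e)" for e
    proof -
      have "(\<Sum>c\<in>T. d' c * v c e) = d' p * v p e + (\<Sum>c\<in>T - {p}. d' c * v c e)"
        using p insert.prems by (simp add: sum.remove)
      also have "(\<Sum>c\<in>T - {p}. d' c * v c e) = (\<Sum>c\<in>T - {p}. d c * v c e)"
        by (rule sum.cong) (auto simp: d'_def)
      also have "d' p * v p e = - (\<Sum>c\<in>T - {p}. d c * (v c i / v p i * v p e))"
        by (simp add: d'_def sum_distrib_right sum_divide_distrib mult.assoc)
      also have "- (\<Sum>c\<in>T - {p}. d c * (v c i / v p i * v p e)) + (\<Sum>c\<in>T - {p}. d c * v c e)
          = (\<Sum>c\<in>T - {p}. d c * u c e)"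
        unfolding u_def right_diff_distrib sum_subtractf by simp
      finally show ?thesis .
    qed
    have "(\<Sum>c\<in>T - {p}. d c * u c i) = 0" using p by (simp add: u_def)
    then show ?thesis using d split
      by (intro exI[of _ d'] conjI) (auto simp: d'_def)
  qed
qed

subsection \<open>Sparse minimizers\<close>

definition eta :: "real \<Rightarrow> real" where
  "eta t = - t * ln t"

lemma eta_0 [simp]: "eta 0 = 0"
  by (simp add: eta_def)

text \<open>Concavity by way of \<open>ln x \<le> x - 1\<close>. The point \<open>b = 0\<close> is
  included because the motion in \<open>reduce_support_aux\<close> ends where a coordinate
  vanishes.\<close>

lemma eta_tangent:
  assumes "0 < a" "0 \<le> b" shows "eta b \<le> eta a + (- ln a - 1) * (b - a)"
proof (cases "b = 0")
  case True
  then show ?thesis using assms by (simp add: eta_def algebra_simps)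
next
  case False
  then have b: "0 < b" using assms by simp
  have "b * ln (a / b) \<le> b * (a / b - 1)"
    using assms b by (intro mult_left_mono ln_le_minus_one) auto
  then show ?thesis using assms b by (simp add: eta_def ln_div algebra_simps)
qed

text \<open>\<open>a C\<close> is the mass of each of the \<open>length C\<close> atoms of the cycle \<open>C\<close>,
  so the weight of the cycle measure in the mixture is \<open>length C * a C\<close>.\<close>

definition feasible :: "nat \<Rightarrow> (bool list \<Rightarrow> real) \<Rightarrow> (bool list list \<Rightarrow> real) set" where
  "feasible k f = {a. (\<forall>C. 0 \<le> a C) \<and> (\<forall>C. C \<notin> cycles k \<longrightarrow> a C = 0) \<and>
     (\<forall>e. (\<Sum>C\<in>cycles k. a C * of_bool (e \<in> set C)) = f e)}"

text \<open>The Shannon entropy of the mixture if all \<open>length C\<close> atoms of all lists in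
  \<open>cycles k\<close> are counted as different points.\<close>

definition cost :: "nat \<Rightarrow> (bool list list \<Rightarrow> real) \<Rightarrow> real" where
  "cost k a = (\<Sum>C\<in>cycles k. real (length C) * eta (a C))"

text \<open>For a feasible \<open>a\<close> this is linear independence of the edge indicators of
  the cycles in its support, so that \<open>a\<close> is a vertex of the polytope
  \<open>feasible k f\<close>.\<close>

definition basic :: "nat \<Rightarrow> (bool list list \<Rightarrow> real) \<Rightarrow> bool" where
  "basic k a \<longleftrightarrow> (\<forall>d. {C :: bool list list. d C \<noteq> (0 :: real)} \<subseteq> {C. a C \<noteq> 0} \<and>
     (\<forall>e :: bool list. (\<Sum>C\<in>cycles k. d C * of_bool (e \<in> set C)) = 0) \<longrightarrow> (\<forall>C. d C = 0))"

lemma basicD: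
  fixes d :: "bool list list \<Rightarrow> real"
  assumes "basic k a" "{C. d C \<noteq> 0} \<subseteq> {C. a C \<noteq> 0}"
    "\<And>e. (\<Sum>C\<in>cycles k. d C * of_bool (e \<in> set C)) = 0"
  shows "d C = 0"
proof -
  have "(\<forall>C. d C = 0)"
    by (rule assms(1)[unfolded basic_def, THEN spec, THEN mp]) (rule conjI assms(2) allI assms(3))+
  then show ?thesis ..
qed

lemma finite_support:
  assumes "a \<in> feasible k f" shows "finite {C. a C \<noteq> 0}" "{C. a C \<noteq> 0} \<subseteq> cycles k"
proof -
  show "{C. a C \<noteq> 0} \<subseteq> cycles k" using assms by (auto simp: feasible_def)
  then show "finite {C. a C \<noteq> 0}" by (rule finite_subset) simp
qed

text \<open>Counts pairs of a cycle and one of its edges in two ways. As feasibility fixes the sums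
  on the edges, it fixes the total weight of the cycles too.\<close>

lemma sum_length_cycles:
  "(\<Sum>C\<in>cycles k. d C * real (length C))
     = (\<Sum>e\<in>edges k. \<Sum>C\<in>cycles k. d C * of_bool (e \<in> set C))"
proof -
  have "(\<Sum>C\<in>cycles k. d C * real (length C))
      = (\<Sum>C\<in>cycles k. d C * (\<Sum>e\<in>edges k. of_bool (e \<in> set C)))"
    by (intro sum.cong refl arg_cong2[of _ _ _ _ "(*)"] sum_of_bool_cycle[symmetric])
  then show ?thesis unfolding sum_distrib_left by (simp only:) (rule sum.swap)
qed

text \<open>Moving along \<open>d\<close> until a coordinate vanishes. By concavity the cost does not
  increase if its derivative along \<open>d\<close> is nonpositive.\<close>

lemma reduce_support_aux:
  assumes a: "a \<in> feasible k f" and d: "{C. d C \<noteq> 0} \<subseteq> {C. a C \<noteq> 0}" "\<exists>C. d C \<noteq> 0"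
    "\<And>e. (\<Sum>C\<in>cycles k. d C * of_bool (e \<in> set C)) = 0"
    and slope: "(\<Sum>C\<in>cycles k. real (length C) * ((- ln (a C) - 1) * d C)) \<le> 0"
  shows "\<exists>b\<in>feasible k f. {C. b C \<noteq> 0} \<subset> {C. a C \<noteq> 0} \<and> cost k b \<le> cost k a"
proof -
  have supp: "{C. d C \<noteq> 0} \<subseteq> cycles k" using d(1) finite_support(2)[OF a] by blast
  have a0: "0 \<le> a C" for C using a by (simp add: feasible_def)
  define N where "N = {C. d C < 0}"
  have "N \<subseteq> cycles k" unfolding N_def using supp by force
  then have "finite N" by (rule finite_subset) simp
  \<comment> \<open>The sum of \<open>d\<close> with the positive weights \<open>length C\<close> is
    \<open>0\<close>, so a nonzero \<open>d\<close> has a negative coordinate.\<close>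
  have "N \<noteq> {}"
  proof
    assume "N = {}"
    then have nn: "0 \<le> d C" for C by (auto simp: N_def not_less)
    have sum_0: "(\<Sum>C\<in>cycles k. d C * real (length C)) = 0"
      unfolding sum_length_cycles d(3) by (rule sum.neutral_const)
    have "d C = 0" if C: "C \<in> cycles k" for C
    proof -
      have "d C * real (length C) = 0"
        by (rule sum_nonneg_0[OF finite_cycles mult_nonneg_nonneg[OF nn of_nat_0_le_iff] sum_0 C])
      with cyclesD(1)[OF C] show ?thesis by simp
    qed
    then show False using d(2) supp by blast
  qed
  \<comment> \<open>The largest step that keeps \<open>a + t * d\<close> nonnegative; the coordinate
    \<open>D\<close> attaining the minimum reaches \<open>0\<close>.\<close>
  define t where "t = Min ((\<lambda>C. a C / - d C) ` N)"
  have "t \<in> (\<lambda>C. a C / - d C) ` N" unfolding t_def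
    using \<open>finite N\<close> \<open>N \<noteq> {}\<close> by (intro Min_in) auto
  then obtain D where D: "D \<in> N" "t = a D / - d D" by auto
  have t_le: "t \<le> a C / - d C" if "C \<in> N" for C
    unfolding t_def using \<open>finite N\<close> that by simp
  have t0: "0 \<le> t" unfolding D(2) using D(1) a0[of D] by (intro divide_nonneg_nonneg) (auto simp: N_def)
  define b where "b C = a C + t * d C" for C
  have b0: "0 \<le> b C" for C
  proof (cases "d C < 0")
    case True
    then have "t * (- d C) \<le> a C" using t_le[of C] by (simp only: N_def mem_Collect_eq pos_le_divide_eq)
    then show ?thesis by (simp add: b_def)
  next
    case False
    then show ?thesis using a0 t0 by (simp add: b_def)
  qed
  have "b \<in> feasible k f"
  proof -
    have "(\<Sum>C\<in>cycles k. b C * of_bool (e \<in> set C)) = f e" for e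
    proof -
      have "(\<Sum>C\<in>cycles k. b C * of_bool (e \<in> set C))
          = (\<Sum>C\<in>cycles k. a C * of_bool (e \<in> set C)) + t * (\<Sum>C\<in>cycles k. d C * of_bool (e \<in> set C))"
        unfolding b_def sum_distrib_left sum.distrib[symmetric]
        by (rule sum.cong) (simp_all add: algebra_simps)
      then show ?thesis using a d(3) by (simp only: feasible_def mem_Collect_eq)
    qed
    moreover have "b C = 0" if "C \<notin> cycles k" for C
    proof -
      have "a C = 0" "d C = 0" using that supp finite_support(2)[OF a] by blast+
      then show ?thesis by (simp add: b_def)
    qed
    ultimately show ?thesis using b0 by (simp add: feasible_def del: sum_mult_of_bool_eq)
  qed
  moreover have "{C. b C \<noteq> 0} \<subset> {C. a C \<noteq> 0}"
  proof
    show "{C. b C \<noteq> 0} \<subseteq> {C. a C \<noteq> 0}"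
    proof (rule Collect_mono, rule impI, rule notI)
      fix C assume C: "b C \<noteq> 0" "a C = 0"
      then have "d C = 0" using d(1) by blast
      then show False using C by (simp add: b_def)
    qed
    have "b D = 0" "d D \<noteq> 0" using D by (auto simp: b_def N_def)
    then have "D \<notin> {C. b C \<noteq> 0}" "D \<in> {C. a C \<noteq> 0}" using d(1) by auto
    then show "{C. b C \<noteq> 0} \<noteq> {C. a C \<noteq> 0}" by metis
  qed
  moreover have "cost k b \<le> cost k a"
  proof -
    have "eta (b C) \<le> eta (a C) + t * ((- ln (a C) - 1) * d C)" for C
    proof (cases "a C = 0")
      case True
      then have "d C = 0" using d(1) by blast
      then show ?thesis by (simp add: b_def)
    next
      case False
      then have "0 < a C" using a0[of C] by simp
      from eta_tangent[OF this b0[of C]] show ?thesis by (simp add: b_def mult.left_commute)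
    qed
    then have "cost k b \<le> (\<Sum>C\<in>cycles k. real (length C) * (eta (a C) + t * ((- ln (a C) - 1) * d C)))"
      unfolding cost_def by (intro sum_mono mult_left_mono) auto
    also have "\<dots> = cost k a + t * (\<Sum>C\<in>cycles k. real (length C) * ((- ln (a C) - 1) * d C))"
      unfolding cost_def sum_distrib_left sum.distrib[symmetric]
      by (intro sum.cong) (auto simp: algebra_simps)
    also have "\<dots> \<le> cost k a" using slope t0 by (simp add: mult_nonneg_nonpos)
    finally show ?thesis .
  qed
  ultimately show ?thesis by blast
qed

text \<open>The directions with zero edge sums form a linear space, so \<open>d\<close> may be
  replaced by \<open>- d\<close>, and one of the two has nonpositive slope.\<close>

lemma reduce_support:
  assumes a: "a \<in> feasible k f" and "\<not> basic k a"
  shows "\<exists>b\<in>feasible k f. {C. b C \<noteq> 0} \<subset> {C. a C \<noteq> 0} \<and> cost k b \<le> cost k a"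
proof -
  obtain d :: "bool list list \<Rightarrow> real" where d: "{C. d C \<noteq> 0} \<subseteq> {C. a C \<noteq> 0}" "\<exists>C. d C \<noteq> 0"
    "\<And>e. (\<Sum>C\<in>cycles k. d C * of_bool (e \<in> set C)) = 0"
    using assms(2) unfolding basic_def not_all not_imp
    by (elim exE conjE, intro that) (assumption, rule exI, assumption, erule spec)
  let ?L = "\<lambda>d. \<Sum>C\<in>cycles k. real (length C) * ((- ln (a C) - 1) * d C)"
  show ?thesis
  proof (cases "?L d \<le> 0")
    case True
    then show ?thesis using reduce_support_aux[OF a d] by blast
  next
    case False
    let ?d = "\<lambda>C. - d C"
    have "?L ?d = - ?L d" by (simp only: mult_minus_right sum_negf)
    then have "?L ?d \<le> 0" using False by simp
    moreover have "(\<Sum>C\<in>cycles k. ?d C * of_bool (e \<in> set C)) = 0" for e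
      using d(3)[of e] unfolding mult_minus_left sum_negf by simp
    moreover have "{C. ?d C \<noteq> 0} \<subseteq> {C. a C \<noteq> 0}" "\<exists>C. ?d C \<noteq> 0" using d(1,2) by simp_all
    ultimately show ?thesis by (intro reduce_support_aux[OF a, of ?d])
  qed
qed

lemma ex_basic_cost_le:
  assumes "a \<in> feasible k f"
  shows "\<exists>b\<in>feasible k f. basic k b \<and> cost k b \<le> cost k a"
  using assms
proof (induction "card {C. a C \<noteq> 0}" arbitrary: a rule: less_induct)
  case less
  show ?case
  proof (cases "basic k a")
    case True
    then show ?thesis using less.prems by blast
  next
    case False
    then obtain b where b: "b \<in> feasible k f" "{C. b C \<noteq> 0} \<subset> {C. a C \<noteq> 0}" "cost k b \<le> cost k a"
      using reduce_support[OF less.prems False] by (elim bexE conjE) (rule that)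
    have "card {C. b C \<noteq> 0} < card {C. a C \<noteq> 0}"
      using b(2) finite_support(1)[OF less.prems] by (rule psubset_card_mono[rotated])
    from less.hyps[OF this b(1)] obtain c where "c \<in> feasible k f" "basic k c" "cost k c \<le> cost k b"
      by (elim bexE conjE) (rule that)
    with b(3) show ?thesis by (intro bexI[of _ c] conjI) auto
  qed
qed

text \<open>Two basic solutions with equal support differ by a vector that lives on this support and
  has zero edge sums, which \<open>basic\<close> forces to vanish.\<close>

lemma finite_basic: "finite {a \<in> feasible k f. basic k a}"
proof (rule finite_imageD)
  show "finite ((\<lambda>a. {C. a C \<noteq> 0}) ` {a \<in> feasible k f. basic k a})"
    by (rule finite_subset[of _ "Pow (cycles k)"]) (use finite_support(2) in auto)
  show "inj_on (\<lambda>a. {C. a C \<noteq> 0}) {a \<in> feasible k f. basic k a}"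
  proof (rule inj_onI)
    fix a b assume ab: "a \<in> {a \<in> feasible k f. basic k a}" "b \<in> {a \<in> feasible k f. basic k a}"
      and eq: "{C. a C \<noteq> 0} = {C. b C \<noteq> 0}"
    let ?d = "\<lambda>C. a C - b C"
    have *: "(\<Sum>C\<in>cycles k. ?d C * of_bool (e \<in> set C)) = 0" for e
      using ab unfolding left_diff_distrib sum_subtractf
      by (simp add: feasible_def del: sum_mult_of_bool_eq)
    have "{C. ?d C \<noteq> 0} \<subseteq> {C. a C \<noteq> 0}" using eq by fastforce
    then have "?d C = 0" for C
      by (rule basicD[where d = ?d, OF CollectD[OF ab(1), THEN conjunct2] _ *])
    then show "a = b" by (simp add: fun_eq_iff)
  qed
qed

text \<open>An edge ending in \<open>True\<close> is given by its start vertex, which accounts for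
  \<open>2 ^ k\<close>; the loop is added because it lies outside the tree behind
  \<open>circulation_eq_0\<close>.\<close>

lemma card_determining_edges:
  "card (insert (replicate (Suc k) False) {e \<in> edges k. last e}) \<le> 2 ^ k + 1"
proof -
  have "{e \<in> edges k. last e} \<subseteq> (\<lambda>v. v @ [True]) ` {v. length v = k}"
  proof
    fix e assume "e \<in> {e \<in> edges k. last e}"
    then show "e \<in> (\<lambda>v. v @ [True]) ` {v. length v = k}"
      by (cases e rule: rev_cases) (auto simp: edges_def)
  qed
  then have "card {e \<in> edges k. last e} \<le> card {v :: bool list. length v = k}"
    by (intro surj_card_le finite_bool_lists)
  then show ?thesis using card_bool_lists[of k] by (simp add: card_insert_if)
qed

text \<open>With more cycles than determining edges, a nontrivial combination of the cycles vanishes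
  on those edges. Being a circulation, it vanishes everywhere, against \<open>basic\<close>.\<close>

lemma card_support_basic:
  assumes a: "a \<in> feasible k f" and "basic k a"
  shows "card {C. a C \<noteq> 0} \<le> 2 ^ k + 1"
proof (rule ccontr)
  let ?I = "insert (replicate (Suc k) False) {e \<in> edges k. last e}"
  let ?T = "{C. a C \<noteq> 0}"
  note T = finite_support[OF a]
  assume "\<not> ?thesis"
  then have card: "card ?I < card ?T" using card_determining_edges[of k] by linarith
  have "\<exists>d. (\<exists>C\<in>?T. d C \<noteq> (0 :: real)) \<and> (\<forall>e\<in>?I. (\<Sum>C\<in>?T. d C * of_bool (e \<in> set C)) = 0)"
    by (rule homogeneous_system) (simp, fact+)
  then obtain d :: "bool list list \<Rightarrow> real" where d: "\<exists>C\<in>?T. d C \<noteq> 0"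
    "\<forall>e\<in>?I. (\<Sum>C\<in>?T. d C * of_bool (e \<in> set C)) = 0"
    by (elim exE conjE) (rule that)
  define d' where "d' C = (if a C = 0 then 0 else d C)" for C
  define g where "g e = (\<Sum>C\<in>cycles k. d' C * of_bool (e \<in> set C))" for e
  have g: "g e = (\<Sum>C\<in>?T. d C * of_bool (e \<in> set C))" for e
    unfolding g_def by (rule sum.mono_neutral_cong_right) (use T(2) in \<open>auto simp: d'_def\<close>)
  have g0: "g e = 0" if "e \<in> ?I" for e
    using d(2) that unfolding g by (rule bspec)
  have circ: "circulation k g"
    unfolding g_def by (rule circulation_sum) (rule circulation_cycle)
  have "g e = 0" if "e \<in> edges k" for e
  proof (rule circulation_eq_0[OF circ _ _ that])
    show "g e' = 0" if "e' \<in> edges k" "last e'" for e' by (rule g0) (use that in blast)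
    show "g (replicate (Suc k) False) = 0" by (rule g0) blast
  qed
  moreover have "g e = 0" if "e \<notin> edges k" for e
    unfolding g_def
  proof (rule sum.neutral, rule ballI)
    fix C assume "C \<in> cycles k"
    then have "e \<notin> set C" using that cyclesD(2) by blast
    then show "d' C * of_bool (e \<in> set C) = 0" by simp
  qed
  ultimately have g_0: "(\<Sum>C\<in>cycles k. d' C * of_bool (e \<in> set C)) = 0" for e
    unfolding g_def[symmetric] by (cases "e \<in> edges k")
  have "{C. d' C \<noteq> 0} \<subseteq> ?T" by (auto simp: d'_def)
  then have d'_0: "d' C = 0" for C by (rule basicD[OF \<open>basic k a\<close> _ g_0])
  from d(1) obtain C where "a C \<noteq> 0" "d C \<noteq> 0" by blast
  then show False using d'_0[of C] by (simp add: d'_def)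
qed

lemma ex_sparse_minimizer:
  assumes "feasible k f \<noteq> {}"
  obtains a where "a \<in> feasible k f" "card {C. a C \<noteq> 0} \<le> 2 ^ k + 1"
    "\<And>b. b \<in> feasible k f \<Longrightarrow> cost k a \<le> cost k b"
proof -
  let ?B = "{a \<in> feasible k f. basic k a}"
  have "?B \<noteq> {}" using assms ex_basic_cost_le by blast
  define a where "a = arg_min_on (cost k) ?B"
  have a: "a \<in> feasible k f" "basic k a"
    using arg_min_if_finite(1)[OF finite_basic \<open>?B \<noteq> {}\<close>, of "cost k"] unfolding a_def by auto
  have least: "cost k a \<le> cost k b" if "b \<in> feasible k f" "basic k b" for b
    unfolding a_def using that by (intro arg_min_least[OF finite_basic \<open>?B \<noteq> {}\<close>] CollectI conjI)
  have "cost k a \<le> cost k b" if "b \<in> feasible k f" for b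
  proof -
    obtain c where c: "c \<in> feasible k f" "basic k c" "cost k c \<le> cost k b"
      using ex_basic_cost_le[OF \<open>b \<in> feasible k f\<close>] by (elim bexE conjE) (rule that)
    show ?thesis using least[OF c(1,2)] c(3) by (rule order_trans)
  qed
  then show thesis by (rule that[OF a(1) card_support_basic[OF a]])
qed

subsection \<open>Entropy of marginals\<close>

abbreviation word :: "nat \<Rightarrow> (int \<Rightarrow> bool) \<Rightarrow> bool list" where
  "word j x \<equiv> map x [0..int j]"

lemma space_Omega [simp]: "space Omega = UNIV"
  by (simp add: Omega_def space_PiM)

lemma measurable_coordinate: "(\<lambda>x. x i) \<in> Omega \<rightarrow>\<^sub>M count_space UNIV"
  unfolding Omega_def by (rule measurable_component_singleton) simp

lemma sets_map_eq: "{x. map x js = w} \<in> sets Omega"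
proof (induction js arbitrary: w)
  case Nil
  then show ?case using sets.top[of Omega] by (cases w) simp_all
next
  case (Cons i js)
  show ?case
  proof (cases w)
    case Nil
    then show ?thesis by simp
  next
    case (Cons b v)
    have "{x. x i = b} = (\<lambda>x. x i) -` {b} \<inter> space Omega" by auto
    also have "\<dots> \<in> sets Omega" by (rule measurable_sets[OF measurable_coordinate]) simp
    finally have "{x. x i = b} \<inter> {x. map x js = v} \<in> sets Omega" using Cons.IH by blast
    moreover have "{x. map x (i # js) = w} = {x. x i = b} \<inter> {x. map x js = v}"
      using Cons by auto
    ultimately show ?thesis by simp
  qed
qed

lemma measurable_map [measurable]: "(\<lambda>x. map x js) \<in> Omega \<rightarrow>\<^sub>M count_space UNIV"
proof -
  have "(\<lambda>x. map x js) -` {w} \<inter> space Omega \<in> sets Omega" for w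
    using sets_map_eq[of js w] by (simp add: vimage_def)
  then show ?thesis by (subst measurable_count_space_eq_countable) auto
qed

lemma measurable_shift: "shift \<in> Omega \<rightarrow>\<^sub>M Omega"
  unfolding Omega_def shift_def
  by (rule measurable_PiM_single') (auto intro: measurable_component_singleton)

text \<open>Centred windows exhaust the integers, whereas the windows \<open>0..j\<close> of the
  marginals leave the negative coordinates free.\<close>

lemma singleton_eq_INT_windows:
  "{x} = (\<Inter>n::nat. {y. map y [- int n..int n] = map x [- int n..int n]})"
proof (intro equalityI subsetI)
  fix y assume "y \<in> (\<Inter>n::nat. {y. map y [- int n..int n] = map x [- int n..int n]})"
  then have "map y [- int n..int n] = map x [- int n..int n]" for n by blast
  then have *: "y i = x i" if "i \<in> {- int n..int n}" for n i using that by (simp add: map_eq_conv)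
  have "y i = x i" for i by (rule *[of i "nat \<bar>i\<bar>"]) auto
  then show "y \<in> {x}" by (simp add: fun_eq_iff)
qed auto

lemma sets_singleton: "{x} \<in> sets Omega"
  unfolding singleton_eq_INT_windows[of x] by (intro sets.countable_INT) (auto simp only: intro: sets_map_eq)

text \<open>The information content \<open>- ln t\<close>, with the value \<open>\<infinity>\<close> at \<open>0\<close>, where \<open>ln\<close> would give \<open>0\<close>.\<close>

definition info :: "real \<Rightarrow> ennreal" where
  "info t = (if t \<le> 0 then \<infinity> else ennreal (- ln t))"

lemma info_antimono: "s \<le> t \<Longrightarrow> info t \<le> info s"
  by (auto simp: info_def intro!: ennreal_leI)

lemma info_mult:
  assumes "0 \<le> t" "t \<le> 1" shows "info t * ennreal t = ennreal (eta t)"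
  using assms by (cases "t = 0") (auto simp: info_def eta_def ennreal_mult'[symmetric] ln_le_zero_iff mult.commute)

lemma eta_nonneg: "0 \<le> t \<Longrightarrow> t \<le> 1 \<Longrightarrow> 0 \<le> eta t"
  by (cases "t = 0") (auto simp: eta_def intro!: mult_nonneg_nonpos)

lemma marg_entropy_eq: "marg_entropy j \<mu> = (\<Sum>w\<in>{w. length w = Suc j}. eta (measure (marg j \<mu>) {w}))"
  by (simp add: marg_entropy_def eta_def sum_negf)

text \<open>Entropy as mean information. Integrating over configurations puts the entropies of all
  windows on one space, where a longer window increases the integrand pointwise.\<close>

lemma nn_integral_info_distr:
  assumes "prob_space \<mu>" and X [measurable]: "X \<in> \<mu> \<rightarrow>\<^sub>M count_space UNIV"
    and L: "finite L" "\<And>x. X x \<in> L"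
  shows "(\<integral>\<^sup>+x. info (measure \<mu> {y \<in> space \<mu>. X y = X x}) \<partial>\<mu>)
       = ennreal (\<Sum>w\<in>L. eta (measure (distr \<mu> (count_space UNIV) X) {w}))"
proof -
  interpret prob_space \<mu> by fact
  let ?D = "distr \<mu> (count_space UNIV) X"
  interpret D: prob_space ?D by (rule prob_space_distr) fact
  have D: "measure ?D {w} = measure \<mu> {y \<in> space \<mu>. X y = w}" for w
    by (subst measure_distr) (auto intro!: arg_cong[of _ _ "measure \<mu>"])
  have "(\<integral>\<^sup>+x. info (measure \<mu> {y \<in> space \<mu>. X y = X x}) \<partial>\<mu>) = (\<integral>\<^sup>+w. info (measure ?D {w}) \<partial>?D)"
    unfolding D by (subst nn_integral_distr) auto
  also have "\<dots> = (\<integral>\<^sup>+w. info (measure ?D {w}) * indicator L w \<partial>?D)"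
    by (rule nn_integral_cong_AE) (auto simp: AE_distr_iff L(2))
  also have "\<dots> = (\<Sum>w\<in>L. info (measure ?D {w}) * emeasure ?D {w})"
    by (rule nn_integral_indicator_finite) (auto simp: L(1))
  also have "\<dots> = (\<Sum>w\<in>L. ennreal (eta (measure ?D {w})))"
    by (simp add: D.emeasure_eq_measure info_mult)
  also have "\<dots> = ennreal (\<Sum>w\<in>L. eta (measure ?D {w}))"
    by (rule sum_ennreal) (simp add: eta_nonneg)
  finally show ?thesis .
qed

lemma ennreal_marg_entropy:
  assumes "prob_space \<mu>" "sets \<mu> = sets Omega"
  shows "ennreal (marg_entropy j \<mu>) = (\<integral>\<^sup>+x. info (measure \<mu> {y. word j y = word j x}) \<partial>\<mu>)"
proof -
  have "space \<mu> = UNIV" using sets_eq_imp_space_eq[OF assms(2)] by simp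
  moreover have "word j \<in> \<mu> \<rightarrow>\<^sub>M count_space UNIV"
    unfolding measurable_cong_sets[OF assms(2) refl] by (rule measurable_map)
  ultimately show ?thesis
    using nn_integral_info_distr[OF assms(1) _ finite_bool_lists, of "word j" "Suc j"]
    by (simp add: marg_entropy_eq marg_def)
qed

lemma marg_entropy_nonneg:
  assumes "prob_space \<mu>" "sets \<mu> = sets Omega" shows "0 \<le> marg_entropy j \<mu>"
proof -
  have "word j \<in> \<mu> \<rightarrow>\<^sub>M count_space UNIV"
    unfolding measurable_cong_sets[OF assms(2) refl] by (rule measurable_map)
  then interpret D: prob_space "marg j \<mu>"
    unfolding marg_def by (rule prob_space.prob_space_distr[OF assms(1)])
  show ?thesis unfolding marg_entropy_eq by (intro sum_nonneg eta_nonneg) auto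
qed

lemma incseq_marg_entropy:
  assumes "prob_space \<mu>" "sets \<mu> = sets Omega"
  shows "incseq (\<lambda>j. marg_entropy j \<mu>)"
proof (rule incseq_SucI)
  fix j
  interpret prob_space \<mu> by fact
  have upto: "[0..int (Suc j)] = [0..int j] @ [1 + int j]"
    using upto_rec2[of 0 "int (Suc j)"] by (simp add: add.commute)
  have "ennreal (marg_entropy j \<mu>) \<le> ennreal (marg_entropy (Suc j) \<mu>)"
    unfolding ennreal_marg_entropy[OF assms]
  proof (intro nn_integral_mono info_antimono finite_measure_mono)
    show "{y. word (Suc j) y = word (Suc j) x} \<subseteq> {y. word j y = word j x}" for x
      unfolding upto by auto
    show "{y. word j y = word j x} \<in> events" for x
      unfolding assms(2) by (rule sets_map_eq)
  qed
  then show "marg_entropy j \<mu> \<le> marg_entropy (Suc j) \<mu>"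
    using marg_entropy_nonneg[OF assms] by (simp add: ennreal_le_iff)
qed

text \<open>\<open>lim\<close> is a definite description; monotonicity supplies the limit and
  identifies it.\<close>

lemma total_entropy_eq_SUP:
  assumes "prob_space \<mu>" "sets \<mu> = sets Omega"
  shows "total_entropy \<mu> = (SUP j. ereal (marg_entropy j \<mu>))"
  unfolding total_entropy_def
  by (rule limI, rule LIMSEQ_SUP)
     (use incseq_marg_entropy[OF assms] in \<open>simp add: incseq_def\<close>)

text \<open>Monotonicity of \<open>ln\<close>. This is the statement that merging two masses into
  one cannot raise the entropy.\<close>

lemma eta_add_le:
  assumes "0 \<le> s" "0 \<le> t" shows "eta (s + t) \<le> eta s + eta t"
proof (cases "s = 0 \<or> t = 0")
  case False
  then have "s * ln s \<le> s * ln (s + t)" "t * ln t \<le> t * ln (s + t)"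
    using assms by (auto intro!: mult_left_mono)
  then show ?thesis by (simp add: eta_def algebra_simps)
qed auto

lemma eta_sum_le:
  assumes "\<And>i. i \<in> I \<Longrightarrow> 0 \<le> t i" shows "eta (\<Sum>i\<in>I. t i) \<le> (\<Sum>i\<in>I. eta (t i))"
  using assms
proof (induction I rule: infinite_finite_induct)
  case (insert i I)
  then have "eta (t i + (\<Sum>i\<in>I. t i)) \<le> eta (t i) + eta (\<Sum>i\<in>I. t i)"
    by (intro eta_add_le sum_nonneg) auto
  with insert show ?case by simp
qed auto

lemma eta_sum_of_nat_le:
  assumes "\<And>i. i \<in> I \<Longrightarrow> 0 \<le> t i"
  shows "eta (\<Sum>i\<in>I. real (n i) * t i) \<le> (\<Sum>i\<in>I. real (n i) * eta (t i))"
proof -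
  have "eta (real m * s) \<le> real m * eta s" if "0 \<le> s" for m s
    using eta_sum_le[of "{..<m}" "\<lambda>_. s"] that by simp
  then have "(\<Sum>i\<in>I. eta (real (n i) * t i)) \<le> (\<Sum>i\<in>I. real (n i) * eta (t i))"
    using assms by (intro sum_mono) auto
  moreover have "eta (\<Sum>i\<in>I. real (n i) * t i) \<le> (\<Sum>i\<in>I. eta (real (n i) * t i))"
    using assms by (intro eta_sum_le) auto
  ultimately show ?thesis by linarith
qed

subsection \<open>Mixtures of cycle measures\<close>

text \<open>The law behind \<open>nu_cycle\<close>, kept as a pmf, where every set is measurable;
  \<open>nu_cycle\<close> is its image on the product sigma-algebra.\<close>

definition cycle_pmf :: "bool list list \<Rightarrow> (int \<Rightarrow> bool) pmf" where
  "cycle_pmf C = map_pmf (cycle_config C) (pmf_of_set {0..<int (length C)})"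

lemma cycle_config_mod: "cycle_config C (s mod int (length C)) = cycle_config C s"
  by (simp add: cycle_config_def fun_eq_iff mod_add_right_eq)

lemma shift_cycle_config: "shift (cycle_config C s) = cycle_config C (s + 1)"
  by (simp add: cycle_config_def shift_def fun_eq_iff ac_simps)

text \<open>The shift advances the starting position by one modulo the period, which permutes the
  positions.\<close>

lemma map_shift_cycle_pmf:
  assumes "C \<noteq> []" shows "map_pmf shift (cycle_pmf C) = cycle_pmf C"
proof -
  let ?p = "int (length C)"
  have p: "0 < ?p" using assms by simp
  have "inj_on (\<lambda>s. (s + 1) mod ?p) {0..<?p}"
  proof (rule inj_onI)
    fix s t assume st: "s \<in> {0..<?p}" "t \<in> {0..<?p}" "(s + 1) mod ?p = (t + 1) mod ?p"
    then have "(s + 1 - 1) mod ?p = (t + 1 - 1) mod ?p" by (rule_tac mod_diff_cong) auto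
    then show "s = t" using st by simp
  qed
  moreover have "(\<lambda>s. (s + 1) mod ?p) ` {0..<?p} \<subseteq> {0..<?p}" using p by auto
  ultimately have "bij_betw (\<lambda>s. (s + 1) mod ?p) {0..<?p} {0..<?p}"
    by (simp add: bij_betw_def endo_inj_surj)
  then have bij: "map_pmf (\<lambda>s. (s + 1) mod ?p) (pmf_of_set {0..<?p}) = pmf_of_set {0..<?p}"
    using p by (intro map_pmf_of_set_bij_betw) auto
  have "map_pmf shift (cycle_pmf C)
      = map_pmf (\<lambda>s. cycle_config C ((s + 1) mod ?p)) (pmf_of_set {0..<?p})"
    by (simp add: cycle_pmf_def pmf.map_comp comp_def shift_cycle_config cycle_config_mod)
  also have "\<dots> = map_pmf (cycle_config C) (map_pmf (\<lambda>s. (s + 1) mod ?p) (pmf_of_set {0..<?p}))"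
    by (simp add: pmf.map_comp comp_def)
  finally show ?thesis unfolding bij cycle_pmf_def[symmetric] .
qed

text \<open>With these counts the mass of a word in a mixture is a combination of the values
  \<open>a C\<close> with natural coefficients, the form that \<open>eta_sum_of_nat_le\<close>
  treats.\<close>

definition reading_count :: "nat \<Rightarrow> bool list list \<Rightarrow> bool list \<Rightarrow> nat" where
  "reading_count j C w = card {s \<in> {0..<int (length C)}. word j (cycle_config C s) = w}"

lemma pmf_word_cycle_pmf:
  assumes "C \<noteq> []"
  shows "pmf (map_pmf (word j) (cycle_pmf C)) w = real (reading_count j C w) / real (length C)"
proof -
  have "pmf (map_pmf (word j) (cycle_pmf C)) w
      = measure (pmf_of_set {0..<int (length C)}) {s. word j (cycle_config C s) = w}"
    by (simp add: cycle_pmf_def pmf.map_comp pmf_map vimage_def comp_def)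
  also have "\<dots> = real (reading_count j C w) / real (length C)"
    using assms by (subst measure_pmf_of_set) (auto simp: reading_count_def Int_def)
  finally show ?thesis .
qed

lemma sum_reading_count:
  "(\<Sum>w\<in>{w. length w = Suc j}. reading_count j C w) = length C"
proof -
  have "(\<Sum>w\<in>{w. length w = Suc j}. reading_count j C w)
      = card (\<Union>w\<in>{w. length w = Suc j}. {s \<in> {0..<int (length C)}. word j (cycle_config C s) = w})"
    unfolding reading_count_def
    by (rule card_UN_disjoint[symmetric])
       (rule finite_bool_lists, rule ballI, rule finite_Collect_conjI, simp, blast)
  also have "(\<Union>w\<in>{w. length w = Suc j}. {s \<in> {0..<int (length C)}. word j (cycle_config C s) = w})
      = {0..<int (length C)}" by auto
  finally show ?thesis by simp
qed

text \<open>Consecutive edges overlap in \<open>k\<close> letters: dropping the first letter of an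
  edge leaves the beginning of the next one.\<close>

lemma nth_cycle:
  assumes "C \<in> cycles k" "i \<le> k"
  shows "s < length C \<Longrightarrow> (C ! s) ! i = hd (C ! ((s + i) mod length C))"
  using assms(2)
proof (induction i arbitrary: s)
  case 0
  then have "length (C ! s) = Suc k" using cyclesD(2)[OF assms(1)] by (force simp: edges_def)
  then show ?case using 0 by (cases "C ! s") auto
next
  case (Suc i)
  let ?t = "(s + 1) mod length C"
  have t: "?t < length C" using cyclesD(4)[OF assms(1)] by simp
  have l: "length (C ! u) = Suc k" if "u < length C" for u
    using cyclesD(2)[OF assms(1)] nth_mem[OF that] by (auto simp: edges_def)
  have "(C ! s) ! Suc i = tl (C ! s) ! i" using l[OF Suc.prems(1)] Suc.prems by (simp add: nth_tl)
  also have "\<dots> = butlast (C ! ?t) ! i" using cyclesD(5)[OF assms(1) Suc.prems(1)] by simp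
  also have "\<dots> = (C ! ?t) ! i" using l[OF t] Suc.prems(2) by (simp add: nth_butlast)
  also have "\<dots> = hd (C ! ((?t + i) mod length C))" using Suc t by simp
  also have "(?t + i) mod length C = (s + Suc i) mod length C" by (simp add: mod_simps)
  finally show ?case .
qed

lemma word_cycle_config:
  assumes "C \<in> cycles k" "s < length C"
  shows "word k (cycle_config C (int s)) = C ! s"
proof (rule nth_equalityI)
  have l: "length (C ! s) = Suc k"
    using cyclesD(2)[OF assms(1)] nth_mem[OF assms(2)] by (auto simp: edges_def)
  then show "length (word k (cycle_config C (int s))) = length (C ! s)" by simp
  fix i assume "i < length (word k (cycle_config C (int s)))"
  then have i: "i \<le> k" by simp
  have "word k (cycle_config C (int s)) ! i = hd (C ! nat ((int i + int s) mod int (length C)))"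
    using i nth_upto[of 0 i "int k"] by (simp add: cycle_config_def)
  also have "(int i + int s) mod int (length C) = int ((s + i) mod length C)"
    by (simp add: zmod_int add.commute)
  finally show "word k (cycle_config C (int s)) ! i = C ! s ! i"
    using nth_cycle[OF assms(1) i assms(2)] by simp
qed

text \<open>The windows of length \<open>k + 1\<close> along the periodic configuration are the
  edges themselves, and a cycle repeats no edge.\<close>

lemma reading_count_cycle:
  assumes "C \<in> cycles k" shows "reading_count k C e = of_bool (e \<in> set C)"
proof -
  have "{s \<in> {0..<int (length C)}. word k (cycle_config C s) = e}
      = int ` {s. s < length C \<and> C ! s = e}" (is "?L = ?R")
  proof (intro equalityI subsetI)
    fix s assume s: "s \<in> ?L"
    then have "word k (cycle_config C (int (nat s))) = C ! nat s"
      by (intro word_cycle_config[OF assms]) auto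
    with s show "s \<in> ?R" by (intro image_eqI[of _ _ "nat s"]) auto
  qed (auto simp: word_cycle_config[OF assms])
  then have *: "reading_count k C e = card {s. s < length C \<and> C ! s = e}"
    by (simp add: reading_count_def card_image)
  show ?thesis
  proof (cases "e \<in> set C")
    case True
    then obtain i where i: "i < length C" "C ! i = e" by (auto simp: in_set_conv_nth)
    then have "{s. s < length C \<and> C ! s = e} = {i}"
      using cyclesD(3)[OF assms] by (auto simp: nth_eq_iff_index_eq)
    then show ?thesis using * True by simp
  next
    case False
    then have "{s. s < length C \<and> C ! s = e} = {}" by (auto simp: in_set_conv_nth)
    then show ?thesis using * False by simp
  qed
qed

lemma feasible_sum_length:
  assumes "a \<in> feasible k (pmf p)" "set_pmf p \<subseteq> edges k"
  shows "(\<Sum>C\<in>cycles k. real (length C) * a C) = 1"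
proof -
  have "(\<Sum>C\<in>cycles k. real (length C) * a C) = (\<Sum>e\<in>edges k. pmf p e)"
    using assms(1) sum_length_cycles[of a k]
    by (simp add: feasible_def mult.commute del: sum_mult_of_bool_eq)
  also have "\<dots> = 1" using assms(2) by (intro sum_pmf_eq_1) auto
  finally show ?thesis .
qed

definition mixture :: "(bool list list \<Rightarrow> real) \<Rightarrow> (int \<Rightarrow> bool) pmf" where
  "mixture a = bind_pmf (embed_pmf (\<lambda>C. real (length C) * a C)) cycle_pmf"

lemma pmf_embed_length:
  assumes "a \<in> feasible k (pmf p)" "set_pmf p \<subseteq> edges k"
  shows "pmf (embed_pmf (\<lambda>C. real (length C) * a C)) C = real (length C) * a C"
proof (rule pmf_embed_pmf)
  show "0 \<le> real (length C) * a C" for C using assms(1) by (simp add: feasible_def)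
  have "(\<integral>\<^sup>+C. ennreal (real (length C) * a C) \<partial>count_space UNIV)
      = (\<Sum>C\<in>cycles k. ennreal (real (length C) * a C))"
    using assms(1) by (intro nn_integral_count_space'[OF finite_cycles])
      (auto simp: feasible_def)
  also have "\<dots> = ennreal (\<Sum>C\<in>cycles k. real (length C) * a C)"
    using assms(1) by (intro sum_ennreal) (simp add: feasible_def)
  finally show "(\<integral>\<^sup>+C. ennreal (real (length C) * a C) \<partial>count_space UNIV) = 1"
    using feasible_sum_length[OF assms] by simp
qed

lemma set_embed_length:
  assumes "a \<in> feasible k (pmf p)" "set_pmf p \<subseteq> edges k"
  shows "set_pmf (embed_pmf (\<lambda>C. real (length C) * a C)) \<subseteq> {C. a C \<noteq> 0}"
  using pmf_embed_length[OF assms] by (auto simp: set_pmf_iff)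

lemma measure_mixture:
  assumes "a \<in> feasible k (pmf p)" "set_pmf p \<subseteq> edges k"
  shows "measure (mixture a) A = (\<Sum>C\<in>cycles k. real (length C) * a C * measure (cycle_pmf C) A)"
proof -
  let ?W = "embed_pmf (\<lambda>C. real (length C) * a C)"
  have sub: "set_pmf ?W \<subseteq> cycles k"
    using set_embed_length[OF assms] finite_support(2)[OF assms(1)] by blast
  have "emeasure (mixture a) A = (\<integral>\<^sup>+C. emeasure (cycle_pmf C) A \<partial>?W)"
    by (simp add: mixture_def)
  also have "\<dots> = (\<integral>\<^sup>+C. ennreal (measure (cycle_pmf C) A) \<partial>?W)"
    by (simp add: measure_pmf.emeasure_eq_measure)
  also have "\<dots> = ennreal (\<integral>C. measure (cycle_pmf C) A \<partial>?W)"
    by (intro nn_integral_eq_integral integrable_measure_pmf_finite finite_subset[OF sub]) auto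
  finally have "measure (mixture a) A = (\<integral>C. measure (cycle_pmf C) A \<partial>?W)"
    by (simp add: measure_pmf.emeasure_eq_measure integral_nonneg)
  also have "\<dots> = (\<Sum>C\<in>cycles k. measure (cycle_pmf C) A * pmf ?W C)"
    by (rule integral_measure_pmf_real) (use sub in auto)
  finally show ?thesis unfolding pmf_embed_length[OF assms] by (simp add: mult.commute)
qed

lemma pmf_word_mixture:
  assumes "a \<in> feasible k (pmf p)" "set_pmf p \<subseteq> edges k"
  shows "pmf (map_pmf (word j) (mixture a)) w = (\<Sum>C\<in>cycles k. real (reading_count j C w) * a C)"
proof -
  have "pmf (map_pmf (word j) (mixture a)) w
      = (\<Sum>C\<in>cycles k. real (length C) * a C * pmf (map_pmf (word j) (cycle_pmf C)) w)"
    by (simp add: pmf_map measure_mixture[OF assms])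
  also have "\<dots> = (\<Sum>C\<in>cycles k. real (reading_count j C w) * a C)"
    using cyclesD(1) by (intro sum.cong refl) (simp add: pmf_word_cycle_pmf)
  finally show ?thesis .
qed

definition mixture_measure :: "(bool list list \<Rightarrow> real) \<Rightarrow> (int \<Rightarrow> bool) measure" where
  "mixture_measure a = distr (measure_pmf (mixture a)) Omega id"

lemma measure_distr_Omega: "A \<in> sets Omega \<Longrightarrow> measure (distr (measure_pmf P) Omega id) A = measure (measure_pmf P) A"
  by (subst measure_distr) auto

lemma marg_distr_Omega: "marg j (distr (measure_pmf P) Omega id) = measure_pmf (map_pmf (word j) P)"
  unfolding marg_def map_pmf_rep_eq
  by (subst distr_distr) (auto simp: comp_def)

lemma translation_invariant_mixture:
  assumes "a \<in> feasible k (pmf p)" "set_pmf p \<subseteq> edges k"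
  shows "translation_invariant_prob (mixture_measure a)"
proof -
  let ?W = "embed_pmf (\<lambda>C. real (length C) * a C)"
  have sub: "set_pmf ?W \<subseteq> cycles k"
    using set_embed_length[OF assms] finite_support(2)[OF assms(1)] by blast
  have "map_pmf shift (mixture a) = bind_pmf ?W (\<lambda>C. map_pmf shift (cycle_pmf C))"
    by (simp add: mixture_def map_bind_pmf)
  also have "\<dots> = mixture a"
    unfolding mixture_def using sub cyclesD(1)
    by (intro bind_pmf_cong refl map_shift_cycle_pmf) blast
  finally have inv: "map_pmf shift (mixture a) = mixture a" .
  have "distr (mixture_measure a) Omega shift = distr (measure_pmf (mixture a)) Omega shift"
    unfolding mixture_measure_def using measurable_shift by (subst distr_distr) (auto simp: comp_def)
  also have "\<dots> = distr (measure_pmf (map_pmf shift (mixture a))) Omega id"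
    unfolding map_pmf_rep_eq by (subst distr_distr) (auto simp: comp_def)
  finally have "distr (mixture_measure a) Omega shift = mixture_measure a"
    unfolding inv mixture_measure_def .
  moreover have "prob_space (mixture_measure a)"
    unfolding mixture_measure_def by (rule measure_pmf.prob_space_distr) simp
  ultimately show ?thesis
    unfolding translation_invariant_prob_def by (simp add: mixture_measure_def)
qed

lemma marg_mixture:
  assumes "a \<in> feasible k (pmf p)" "set_pmf p \<subseteq> edges k"
  shows "marg k (mixture_measure a) = measure_pmf p"
proof -
  have "map_pmf (word k) (mixture a) = p"
  proof (rule pmf_eqI)
    fix e
    have "pmf (map_pmf (word k) (mixture a)) e = (\<Sum>C\<in>cycles k. a C * of_bool (e \<in> set C))"
      unfolding pmf_word_mixture[OF assms]
      by (intro sum.cong refl) (simp add: reading_count_cycle)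
    then show "pmf (map_pmf (word k) (mixture a)) e = pmf p e"
      using assms(1) by (simp only: feasible_def mem_Collect_eq)
  qed
  then show ?thesis by (simp add: mixture_measure_def marg_distr_Omega)
qed

text \<open>A word collects the masses of all atoms that show it, and merging them does not raise
  the entropy. Summed over all words, the counts return the number of atoms.\<close>

lemma marg_entropy_mixture_le:
  assumes "a \<in> feasible k (pmf p)" "set_pmf p \<subseteq> edges k"
  shows "marg_entropy j (mixture_measure a) \<le> cost k a"
proof -
  have a0: "0 \<le> a C" for C using assms(1) by (simp add: feasible_def)
  have "marg_entropy j (mixture_measure a)
      = (\<Sum>w\<in>{w. length w = Suc j}. eta (\<Sum>C\<in>cycles k. real (reading_count j C w) * a C))"
    by (simp add: marg_entropy_eq mixture_measure_def marg_distr_Omega measure_pmf_single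
        pmf_word_mixture[OF assms])
  also have "\<dots> \<le> (\<Sum>w\<in>{w. length w = Suc j}. \<Sum>C\<in>cycles k. real (reading_count j C w) * eta (a C))"
    using a0 by (intro sum_mono eta_sum_of_nat_le)
  also have "\<dots> = (\<Sum>C\<in>cycles k. \<Sum>w\<in>{w. length w = Suc j}. real (reading_count j C w) * eta (a C))"
    by (rule sum.swap)
  also have "\<dots> = cost k a"
    unfolding cost_def sum_distrib_right[symmetric] of_nat_sum[symmetric] sum_reading_count ..
  finally show ?thesis .
qed

lemma total_entropy_mixture_le:
  assumes "a \<in> feasible k (pmf p)" "set_pmf p \<subseteq> edges k"
  shows "total_entropy (mixture_measure a) \<le> ereal (cost k a)"
proof -
  have "prob_space (mixture_measure a)" "sets (mixture_measure a) = sets Omega"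
    using translation_invariant_mixture[OF assms] by (simp_all add: translation_invariant_prob_def)
  then show ?thesis
    using marg_entropy_mixture_le[OF assms] by (simp add: total_entropy_eq_SUP SUP_le_iff)
qed

section \<open>Locally translation invariant laws as circulations\<close>

lemma restrict_eq_iff: "restrict f A = restrict g A \<longleftrightarrow> (\<forall>x\<in>A. f x = g x)"
  by (auto simp: restrict_def fun_eq_iff)

text \<open>The window \<open>0..k - 1\<close> and its translate by one carry the start vertex
  \<open>butlast\<close> and the end vertex \<open>tl\<close> of an edge, so LTI gives both vertices
  the same law.\<close>

lemma LTI_circulation:
  assumes "LTI k p" shows "circulation k (pmf p)"
proof -
  have sub: "set_pmf p \<subseteq> edges k" using assms by (simp add: LTI_def edges_def)
  have sum_eq: "(\<Sum>e\<in>edges k. pmf p e * of_bool (g e = v)) = measure p {e. g e = v}" for g v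
  proof -
    have "(\<Sum>e\<in>edges k. pmf p e * of_bool (g e = v)) = measure p {e \<in> edges k. g e = v}"
      by (subst measure_measure_pmf_finite, simp) (rule sum_of_bool_Collect[OF finite_edges])
    also have "\<dots> = measure p {e. g e = v}"
      by (rule measure_pmf.finite_measure_eq_AE) (use sub in \<open>auto simp: AE_measure_pmf_iff\<close>)
    finally show ?thesis .
  qed
  have "measure p {e. tl e = v} = measure p {e. butlast e = v}" for v
  proof (cases "length v = k")
    case False
    have "measure p {e. tl e = v} = 0" "measure p {e. butlast e = v} = 0"
      using sub False by (auto simp: measure_pmf_zero_iff edges_def)
    then show ?thesis by simp
  next
    case True
    let ?A = "{0..<k}"
    let ?B = "(\<lambda>i. i + 1) ` ?A"
    \<comment> \<open>The vertex \<open>v\<close> written on the coordinates \<open>1..k\<close>,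
      where both sides of the LTI equation live.\<close>
    let ?r = "restrict (\<lambda>i. v ! (i - 1)) ?B"
    let ?f = "\<lambda>xs. restrict (\<lambda>i. xs ! i) ?B" and ?g = "\<lambda>xs. restrict (\<lambda>i. xs ! (i - 1)) ?B"
    have ball_B: "(\<forall>i\<in>?B. Q i) \<longleftrightarrow> (\<forall>i<k. Q (Suc i))" for Q
    proof (intro iffI allI impI ballI)
      fix i assume "\<forall>i\<in>?B. Q i" "i < k"
      moreover have "i + 1 \<in> ?B" using \<open>i < k\<close> by (intro imageI) simp
      ultimately show "Q (Suc i)" by simp
    next
      fix i assume "\<forall>i<k. Q (Suc i)" "i \<in> ?B"
      then show "Q i" by (elim imageE) simp
    qed
    have "map_pmf ?f p = map_pmf ?g p"
      using assms unfolding LTI_def by (elim conjE allE[of _ ?A] allE[of _ 1]) auto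
    then have "pmf (map_pmf ?f p) ?r = pmf (map_pmf ?g p) ?r" by simp
    moreover have "pmf (map_pmf ?f p) ?r = measure p {e. tl e = v}"
      unfolding pmf_map
    proof (rule measure_pmf.finite_measure_eq_AE)
      have "?f e = ?r \<longleftrightarrow> tl e = v" if "e \<in> set_pmf p" for e
      proof -
        have l: "length e = Suc k" using that sub by (auto simp: edges_def)
        have "?f e = ?r \<longleftrightarrow> (\<forall>i\<in>?B. e ! i = v ! (i - 1))"
          by (rule restrict_eq_iff)
        also have "\<dots> \<longleftrightarrow> (\<forall>i<k. tl e ! i = v ! i)" unfolding ball_B using l by (simp add: nth_tl)
        also have "\<dots> \<longleftrightarrow> tl e = v" using l True by (auto simp: list_eq_iff_nth_eq)
        finally show ?thesis .
      qed
      then show "AE e in p. (e \<in> ?f -` {?r}) = (e \<in> {e. tl e = v})"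
        by (auto simp: AE_measure_pmf_iff)
    qed auto
    moreover have "pmf (map_pmf ?g p) ?r = measure p {e. butlast e = v}"
      unfolding pmf_map
    proof (rule measure_pmf.finite_measure_eq_AE)
      have "?g e = ?r \<longleftrightarrow> butlast e = v" if "e \<in> set_pmf p" for e
      proof -
        have l: "length e = Suc k" using that sub by (auto simp: edges_def)
        have "?g e = ?r \<longleftrightarrow> (\<forall>i\<in>?B. e ! (i - 1) = v ! (i - 1))"
          by (rule restrict_eq_iff)
        also have "\<dots> \<longleftrightarrow> (\<forall>i<k. butlast e ! i = v ! i)" unfolding ball_B using l by (simp add: nth_butlast)
        also have "\<dots> \<longleftrightarrow> butlast e = v" using l True by (auto simp: list_eq_iff_nth_eq)
        finally show ?thesis .
      qed
      then show "AE e in p. (e \<in> ?g -` {?r}) = (e \<in> {e. butlast e = v})"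
        by (auto simp: AE_measure_pmf_iff)
    qed auto
    ultimately show ?thesis by simp
  qed
  then show ?thesis unfolding circulation_def sum_eq by blast
qed

lemma feasible_nonempty:
  assumes "LTI k p" shows "feasible k (pmf p) \<noteq> {}"
proof -
  have "pmf p e = 0" if "e \<notin> edges k" for e
    using assms that by (auto simp: LTI_def edges_def pmf_eq_0_set_pmf)
  then obtain a where a: "\<And>C. 0 \<le> a C"
    "\<And>e. pmf p e = (\<Sum>C\<in>cycles k. a C * of_bool (e \<in> set C))"
    using circulation_decomposition[OF LTI_circulation[OF assms]] by (auto simp del: sum_mult_of_bool_eq)
  \<comment> \<open>The decomposition says nothing about the values of \<open>a\<close> off
    \<open>cycles k\<close>, where \<open>feasible\<close> demands \<open>0\<close>.\<close>
  define b where "b C = (if C \<in> cycles k then a C else 0)" for C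
  have "(\<Sum>C\<in>cycles k. b C * of_bool (e \<in> set C)) = pmf p e" for e
    unfolding a(2) by (rule sum.cong) (auto simp: b_def)
  then have "b \<in> feasible k (pmf p)"
    using a(1) by (simp add: feasible_def b_def del: sum_mult_of_bool_eq)
  then show ?thesis by blast
qed

subsection \<open>Orbits of points of positive mass\<close>

definition translate :: "int \<Rightarrow> (int \<Rightarrow> bool) \<Rightarrow> (int \<Rightarrow> bool)" where
  "translate i x = (\<lambda>n. x (n + i))"

definition orbit :: "(int \<Rightarrow> bool) \<Rightarrow> (int \<Rightarrow> bool) set" where
  "orbit x = range (\<lambda>i. translate i x)"

lemma translate_translate [simp]: "translate i (translate j x) = translate (i + j) x"
  by (simp add: translate_def ac_simps)

lemma translate_0 [simp]: "translate 0 x = x"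
  by (simp add: translate_def)

lemma shift_eq_translate: "shift = translate 1"
  by (simp add: shift_def translate_def fun_eq_iff)

lemma translate_in_orbit [simp]: "translate i x \<in> orbit x"
  by (simp add: orbit_def)

lemma self_in_orbit [simp]: "x \<in> orbit x"
  using translate_in_orbit[of 0 x] by simp

lemma orbit_eq:
  assumes "y \<in> orbit x" shows "orbit y = orbit x"
proof -
  obtain i where y: "y = translate i x" using assms by (auto simp: orbit_def)
  have "translate j x = translate (j - i) y" for j by (simp add: y)
  then have "translate j x \<in> orbit y" for j by simp
  moreover have "translate j y \<in> orbit x" for j by (simp add: y)
  ultimately show ?thesis by (auto simp: orbit_def[of x] orbit_def[of y] image_subset_iff)
qed

lemma orbit_sym: "y \<in> orbit x \<longleftrightarrow> x \<in> orbit y"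
  using orbit_eq self_in_orbit by metis

lemma bij_betw_shift_orbit: "bij_betw shift (orbit x) (orbit x)"
  unfolding shift_eq_translate
proof (rule bij_betw_byWitness[where f' = "translate (- 1)"])
  have "translate i y \<in> orbit x" if "y \<in> orbit x" for i y
    using that by (auto simp: orbit_def)
  then show "translate 1 ` orbit x \<subseteq> orbit x" "translate (- 1) ` orbit x \<subseteq> orbit x" by auto
qed auto

lemma tl_word: "tl (word k x) = butlast (word k (shift x))"
proof (rule nth_equalityI)
  fix i assume "i < length (tl (word k x))"
  then have i: "i < k" by simp
  then show "tl (word k x) ! i = butlast (word k (shift x)) ! i"
    using nth_upto[of 0 i "int k"] nth_upto[of 0 "Suc i" "int k"]
    by (simp add: nth_tl nth_butlast shift_def add.commute)
qed simp

definition orbit_count :: "nat \<Rightarrow> (int \<Rightarrow> bool) \<Rightarrow> bool list \<Rightarrow> real" where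
  "orbit_count k x e = real (card {y \<in> orbit x. word k y = e})"

lemma orbit_count_eq_sum:
  assumes "finite (orbit x)"
  shows "orbit_count k x e = (\<Sum>y\<in>orbit x. of_bool (word k y = e))"
  using sum_of_bool_Collect[OF assms, of "\<lambda>_. 1"] by (simp add: orbit_count_def)

lemma sum_orbit_count:
  assumes "finite (orbit x)"
  shows "(\<Sum>e\<in>edges k. orbit_count k x e * g e) = (\<Sum>y\<in>orbit x. g (word k y))"
proof -
  have "(\<Sum>e\<in>edges k. orbit_count k x e * g e)
      = (\<Sum>e\<in>edges k. \<Sum>y\<in>orbit x. of_bool (word k y = e) * g e)"
    unfolding orbit_count_eq_sum[OF assms] sum_distrib_right ..
  also have "\<dots> = (\<Sum>y\<in>orbit x. \<Sum>e\<in>edges k. of_bool (word k y = e) * g e)"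
    by (rule sum.swap)
  also have "\<dots> = (\<Sum>y\<in>orbit x. g (word k y))"
  proof (rule sum.cong[OF refl])
    fix y
    have "(\<Sum>e\<in>edges k. of_bool (word k y = e) * g e) = (\<Sum>e\<in>edges k. if word k y = e then g e else 0)"
      by (rule sum.cong) auto
    also have "\<dots> = g (word k y)" by (simp add: edges_def finite_bool_lists)
    finally show "(\<Sum>e\<in>edges k. of_bool (word k y = e) * g e) = g (word k y)" .
  qed
  finally show ?thesis .
qed

text \<open>The shift permutes the orbit and moves the edge read at a point to a consecutive edge,
  so one period is a closed walk.\<close>

lemma circulation_orbit_count:
  assumes "finite (orbit x)" shows "circulation k (orbit_count k x)"
  unfolding circulation_def sum_orbit_count[OF assms] tl_word
  using sum.reindex_bij_betw[OF bij_betw_shift_orbit] by auto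

text \<open>The choice depends on \<open>x\<close> only through \<open>orbit_count k x\<close>, so
  all points of an orbit share it.\<close>

definition orbit_mult :: "nat \<Rightarrow> (int \<Rightarrow> bool) \<Rightarrow> bool list list \<Rightarrow> real" where
  "orbit_mult k x = (SOME a. (\<forall>C. 0 \<le> a C) \<and>
     (\<forall>e. orbit_count k x e = (\<Sum>C\<in>cycles k. a C * of_bool (e \<in> set C))) \<and>
     (range (orbit_count k x) \<subseteq> \<int> \<longrightarrow> range a \<subseteq> \<int>))"

text \<open>The lower bound \<open>1\<close> is the form in which integrality of the decomposition
  is passed on.\<close>

lemma orbit_mult:
  assumes "finite (orbit x)"
  shows "0 \<le> orbit_mult k x C"
    and "orbit_count k x e = (\<Sum>C\<in>cycles k. orbit_mult k x C * of_bool (e \<in> set C))"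
    and "orbit_mult k x C \<noteq> 0 \<Longrightarrow> 1 \<le> orbit_mult k x C"
proof -
  have "orbit_count k x e = 0" if "e \<notin> edges k" for e
  proof -
    have "{y \<in> orbit x. word k y = e} = {}" using that by (auto simp: edges_def)
    then show ?thesis unfolding orbit_count_def by (simp only: card.empty of_nat_0)
  qed
  then have "\<exists>a. (\<forall>C. 0 \<le> a C) \<and>
     (\<forall>e. orbit_count k x e = (\<Sum>C\<in>cycles k. a C * of_bool (e \<in> set C))) \<and>
     (range (orbit_count k x) \<subseteq> \<int> \<longrightarrow> range a \<subseteq> \<int>)"
    by (intro circulation_decomposition circulation_orbit_count assms)
       (auto simp: orbit_count_def)
  note ex = someI_ex[OF this, folded orbit_mult_def]
  show "0 \<le> orbit_mult k x C" by (rule ex[THEN conjunct1, THEN spec])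
  show "orbit_count k x e = (\<Sum>C\<in>cycles k. orbit_mult k x C * of_bool (e \<in> set C))" 
    by (rule ex[THEN conjunct2, THEN conjunct1, THEN spec])
  assume "orbit_mult k x C \<noteq> 0"
  moreover have "range (orbit_mult k x) \<subseteq> \<int>" 
    by (rule ex[THEN conjunct2, THEN conjunct2, THEN mp]) (auto simp: orbit_count_def)
  then obtain i where "orbit_mult k x C = of_int i" by (metis Ints_cases rangeI subsetD)
  ultimately show "1 \<le> orbit_mult k x C" using ex[THEN conjunct1, THEN spec, of C] by simp
qed

lemma orbit_mult_cong:
  assumes "y \<in> orbit x" shows "orbit_mult k y = orbit_mult k x"
proof -
  have "orbit_count k y = orbit_count k x"
    unfolding orbit_count_def orbit_eq[OF assms] ..
  then show ?thesis unfolding orbit_mult_def by simp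
qed

lemma sum_orbit_mult:
  assumes "finite (orbit x)"
  shows "(\<Sum>C\<in>cycles k. orbit_mult k x C * real (length C)) = real (card (orbit x))"
  unfolding sum_length_cycles orbit_mult(2)[OF assms, symmetric]
  using sum_orbit_count[OF assms, of k "\<lambda>_. 1"] by simp

lemma orbit_mult_le:
  assumes "finite (orbit x)" "C \<in> cycles k"
  shows "orbit_mult k x C \<le> real (card (orbit x))"
proof -
  have "orbit_mult k x C * 1 \<le> orbit_mult k x C * real (length C)"
    using orbit_mult(1)[OF assms(1)] cyclesD(4)[OF assms(2)] by (intro mult_left_mono) (auto simp: Suc_le_eq)
  also have "\<dots> \<le> (\<Sum>C\<in>cycles k. orbit_mult k x C * real (length C))"
    by (rule member_le_sum[OF assms(2)]) (simp_all add: orbit_mult(1)[OF assms(1)])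
  finally show ?thesis unfolding sum_orbit_mult[OF assms(1)] by simp
qed

section \<open>Invariant atomic laws\<close>

lemma pmf_orbit:
  assumes inv: "\<And>x. pmf P (shift x) = pmf P x" and "y \<in> orbit x"
  shows "pmf P y = pmf P x"
proof -
  have "pmf P (translate i x) = pmf P x" for i
  proof (induction i rule: int_induct[where k = 0])
    case (step1 i)
    then show ?case using inv[of "translate i x"] by (simp add: shift_eq_translate add.commute)
  next
    case (step2 i)
    then show ?case using inv[of "translate (i - 1) x"] by (simp add: shift_eq_translate)
  qed simp
  then show ?thesis using assms(2) by (auto simp: orbit_def)
qed

text \<open>All points of an orbit have the same mass, so a positive mass \<open>m\<close> leaves
  room for at most \<open>1 / m\<close> of them.\<close>

lemma finite_orbit:
  assumes inv: "\<And>x. pmf P (shift x) = pmf P x" and "x \<in> set_pmf P"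
  shows "finite (orbit x)"
proof -
  have pos: "0 < pmf P x" using assms(2) by (rule pmf_positive)
  have "card F \<le> nat \<lceil>1 / pmf P x\<rceil>" if F: "F \<subseteq> orbit x" "finite F" for F
  proof -
    have "real (card F) * pmf P x = (\<Sum>y\<in>F. pmf P x)" by simp
    also have "\<dots> = (\<Sum>y\<in>F. pmf P y)"
      using F(1) by (intro sum.cong refl pmf_orbit[OF inv, symmetric]) blast
    also have "\<dots> = measure P F" using F(2) by (rule measure_measure_pmf_finite[symmetric])
    also have "\<dots> \<le> 1" by (rule measure_pmf.prob_le_1)
    finally have "real (card F) \<le> 1 / pmf P x" using pos by (simp add: field_simps)
    then show ?thesis by linarith
  qed
  then show ?thesis using finite_if_finite_subsets_card_bdd by blast
qed

lemma measure_orbit: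
  assumes inv: "\<And>x. pmf P (shift x) = pmf P x" and "finite (orbit x)"
  shows "measure P (orbit x) = real (card (orbit x)) * pmf P x"
proof -
  have "measure P (orbit x) = (\<Sum>y\<in>orbit x. pmf P y)"
    by (rule measure_measure_pmf_finite[OF assms(2)])
  also have "\<dots> = (\<Sum>y\<in>orbit x. pmf P x)" by (intro sum.cong refl pmf_orbit[OF inv])
  finally show ?thesis by simp
qed

lemma card_orbit_pos: "finite (orbit x) \<Longrightarrow> 0 < card (orbit x)"
  using self_in_orbit[of x] by (simp only: card_gt_0_iff) blast

lemma pmf_of_orbit:
  assumes "finite (orbit x)"
  shows "pmf (pmf_of_set (orbit x)) y = indicator (orbit y) x / real (card (orbit y))"
proof (cases "y \<in> orbit x")
  case True
  then have "x \<in> orbit y" by (simp only: orbit_sym)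
  have ne: "orbit x \<noteq> {}" using self_in_orbit by blast
  show ?thesis
    unfolding pmf_of_set[OF ne assms] orbit_eq[OF True] using True \<open>x \<in> orbit y\<close> by simp
next
  case False
  then have "x \<notin> orbit y" by (simp only: orbit_sym not_False_eq_True)
  have ne: "orbit x \<noteq> {}" using self_in_orbit by blast
  show ?thesis unfolding pmf_of_set[OF ne assms] using False \<open>x \<notin> orbit y\<close> by simp
qed

text \<open>An invariant law is constant along orbits, so choosing a fresh uniform point on the
  orbit does not change it.\<close>

lemma bind_pmf_of_orbit:
  assumes inv: "\<And>x. pmf P (shift x) = pmf P x"
  shows "bind_pmf P (\<lambda>x. pmf_of_set (orbit x)) = P"
proof (rule pmf_eqI)
  fix y
  have "pmf (bind_pmf P (\<lambda>x. pmf_of_set (orbit x))) y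
      = (\<integral>x. indicator (orbit y) x / real (card (orbit y)) \<partial>P)"
    unfolding pmf_bind
    by (rule integral_cong_AE) (auto simp: AE_measure_pmf_iff pmf_of_orbit finite_orbit[OF inv])
  also have "\<dots> = measure P (orbit y) / real (card (orbit y))"
    by (simp add: measure_pmf.emeasure_eq_measure)
  also have "\<dots> = pmf P y"
  proof (cases "y \<in> set_pmf P")
    case True
    then have fin: "finite (orbit y)" by (rule finite_orbit[OF inv])
    have "orbit y \<noteq> {}" using self_in_orbit by blast
    then show ?thesis using fin by (simp add: measure_orbit[OF inv])
  next
    case False
    have "set_pmf P \<inter> orbit y = {}"
    proof (rule ccontr)
      assume "set_pmf P \<inter> orbit y \<noteq> {}"
      then obtain x where x: "x \<in> set_pmf P" "x \<in> orbit y" by blast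
      from pmf_orbit[OF inv x(2)] x(1) False show False by (simp add: set_pmf_iff)
    qed
    then have "measure P (orbit y) = 0" by (simp add: measure_pmf_zero_iff)
    then show ?thesis using False by (simp add: set_pmf_iff)
  qed
  finally show "pmf (bind_pmf P (\<lambda>x. pmf_of_set (orbit x))) y = pmf P y" .
qed

text \<open>Averaging the cycle decompositions of the orbits over \<open>P\<close> gives
  \<open>a\<close>. For each \<open>x\<close> the weights \<open>length C * q C x\<close> sum to 1,
  and each cycle occurring in the orbit of \<open>x\<close> has \<open>a C \<ge> pmf P x\<close>; so
  the mean of \<open>- ln (a C)\<close> under these weights is at most
  \<open>- ln (pmf P x)\<close>.\<close>

lemma ex_feasible_cost_le_pmf:
  assumes inv: "\<And>x. pmf P (shift x) = pmf P x"
    and marg: "map_pmf (word k) P = p"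
    and ent: "(\<integral>\<^sup>+x. ennreal (- ln (pmf P x)) \<partial>P) \<le> ennreal r" and r: "0 \<le> r"
  shows "\<exists>a\<in>feasible k (pmf p). cost k a \<le> r"
proof -
  let ?c = "\<lambda>x. real (card (orbit x))" and ?N = "orbit_mult k"
  have fin: "finite (orbit x)" if "x \<in> set_pmf P" for x
    using that by (rule finite_orbit[OF inv])
  have c: "0 < ?c x" if "x \<in> set_pmf P" for x using card_orbit_pos[OF fin[OF that]] by simp
  \<comment> \<open>In the decomposition of the uniform law on the orbit of \<open>x\<close>, each
    atom of \<open>C\<close> has mass \<open>q C x\<close>.\<close>
  define q where "q C x = ?N x C / ?c x" for C x
  have q0: "0 \<le> q C x" if "x \<in> set_pmf P" for C x
    unfolding q_def by (intro divide_nonneg_nonneg orbit_mult(1) fin that) simp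
  have q1: "q C x \<le> 1" if "x \<in> set_pmf P" "C \<in> cycles k" for C x
    unfolding q_def using orbit_mult_le[OF fin[OF that(1)] that(2)] c[OF that(1)] by simp
  have q_sum: "(\<Sum>C\<in>cycles k. real (length C) * q C x) = 1" if "x \<in> set_pmf P" for x
    using sum_orbit_mult[OF fin[OF that], of k] c[OF that]
    by (simp add: q_def sum_divide_distrib[symmetric] mult.commute)
  have q_int: "integrable P (q C)" if "C \<in> cycles k" for C
    by (rule measure_pmf.integrable_const_bound[where B = 1])
       (use q0 q1 that in \<open>auto simp: AE_measure_pmf_iff\<close>)
  define a where "a C = (if C \<in> cycles k then (\<integral>x. q C x \<partial>P) else 0)" for C
  have a0: "0 \<le> a C" for C
    using q0 by (auto simp: a_def AE_measure_pmf_iff intro!: integral_nonneg_AE)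
  have "(\<Sum>C\<in>cycles k. a C * of_bool (e \<in> set C)) = pmf p e" for e
  proof -
    have "(\<Sum>C\<in>cycles k. a C * of_bool (e \<in> set C))
        = (\<Sum>C\<in>cycles k. \<integral>x. q C x * of_bool (e \<in> set C) \<partial>P)"
      by (intro sum.cong refl) (simp add: a_def)
    also have "\<dots> = (\<integral>x. (\<Sum>C\<in>cycles k. q C x * of_bool (e \<in> set C)) \<partial>P)"
      using q_int by (intro Bochner_Integration.integral_sum[symmetric] integrable_mult_left) auto
    \<comment> \<open>The cycles of an orbit read each edge as often as the orbit does.\<close>
    also have "\<dots> = (\<integral>x. pmf (map_pmf (word k) (pmf_of_set (orbit x))) e \<partial>P)"
    proof (rule integral_cong_AE)
      show "AE x in P. (\<Sum>C\<in>cycles k. q C x * of_bool (e \<in> set C))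
          = pmf (map_pmf (word k) (pmf_of_set (orbit x))) e"
        unfolding AE_measure_pmf_iff
      proof
        fix x assume x: "x \<in> set_pmf P"
        have ne: "orbit x \<noteq> {}" using self_in_orbit by blast
        have "(\<Sum>C\<in>cycles k. q C x * of_bool (e \<in> set C)) = orbit_count k x e / ?c x"
          unfolding orbit_mult(2)[OF fin[OF x]] q_def sum_divide_distrib by simp
        also have "\<dots> = pmf (map_pmf (word k) (pmf_of_set (orbit x))) e"
          unfolding pmf_map measure_pmf_of_set[OF ne fin[OF x]]
          by (simp add: orbit_count_def vimage_def Int_def)
        finally show "(\<Sum>C\<in>cycles k. q C x * of_bool (e \<in> set C))
          = pmf (map_pmf (word k) (pmf_of_set (orbit x))) e" .
      qed
    qed auto
    also have "\<dots> = pmf (map_pmf (word k) (bind_pmf P (\<lambda>x. pmf_of_set (orbit x)))) e"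
      by (simp only: map_bind_pmf pmf_bind)
    also have "\<dots> = pmf p e" unfolding bind_pmf_of_orbit[OF inv] marg ..
    finally show ?thesis .
  qed
  then have feas: "a \<in> feasible k (pmf p)"
    using a0 by (simp add: feasible_def a_def del: sum_mult_of_bool_eq)
  \<comment> \<open>The orbit of \<open>x\<close> alone contributes \<open>pmf P x\<close> times the
    multiplicity of \<open>C\<close> to \<open>a C\<close>.\<close>
  have key: "pmf P x \<le> a C" if x: "x \<in> set_pmf P" and C: "C \<in> cycles k" and N: "?N x C \<noteq> 0" for x C
  proof -
    have "pmf P x * 1 \<le> pmf P x * ?N x C"
      using orbit_mult(3)[OF fin[OF x] N] by (intro mult_left_mono) auto
    also have "\<dots> = measure P (orbit x) * (?N x C / ?c x)"
      using c[OF x] by (simp add: measure_orbit[OF inv fin[OF x]])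
    also have "\<dots> = (\<integral>y. indicator (orbit x) y * (?N x C / ?c x) \<partial>P)"
      by (simp add: measure_pmf.emeasure_eq_measure)
    also have "\<dots> \<le> (\<integral>y. q C y \<partial>P)"
    proof (rule integral_mono_AE[OF _ q_int[OF C]])
      show "integrable P (\<lambda>y. indicator (orbit x) y * (?N x C / ?c x))"
        by (intro integrable_mult_left) (simp add: measure_pmf.emeasure_eq_measure)
      show "AE y in P. indicator (orbit x) y * (?N x C / ?c x) \<le> q C y"
        unfolding AE_measure_pmf_iff
      proof
        fix y assume y: "y \<in> set_pmf P"
        show "indicator (orbit x) y * (?N x C / ?c x) \<le> q C y"
        proof (cases "y \<in> orbit x")
          case True
          then show ?thesis unfolding q_def orbit_mult_cong[OF True] orbit_eq[OF True] by simp
        qed (use q0[OF y] in simp)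
      qed
    qed
    finally show ?thesis using C by (simp add: a_def)
  qed
  let ?g = "\<lambda>x. - ln (pmf P x)"
  let ?h = "\<lambda>x. \<Sum>C\<in>cycles k. q C x * (real (length C) * - ln (a C))"
  have g0: "0 \<le> ?g x" if "x \<in> set_pmf P" for x
    using pmf_positive[OF that] pmf_le_1[of P x] by simp
  have g_int: "integrable P ?g"
  proof (rule integrableI_nonneg)
    show "(\<integral>\<^sup>+x. ennreal (?g x) \<partial>P) < \<infinity>" using ent by (rule order.strict_trans1) simp
  qed (use g0 in \<open>auto simp: AE_measure_pmf_iff\<close>)
  have "ennreal (\<integral>x. ?g x \<partial>P) = (\<integral>\<^sup>+x. ennreal (?g x) \<partial>P)"
    using g0 by (intro nn_integral_eq_integral[symmetric] g_int) (auto simp: AE_measure_pmf_iff)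
  then have "ennreal (\<integral>x. ?g x \<partial>P) \<le> ennreal r" using ent by (simp only:)
  then have g_le: "(\<integral>x. ?g x \<partial>P) \<le> r" by (simp only: ennreal_le_iff[OF r])
  \<comment> \<open>Only the linear factor \<open>a C\<close> of \<open>eta (a C)\<close> is written
    as an integral; the logarithm stays a constant coefficient.\<close>
  have "cost k a = (\<Sum>C\<in>cycles k. (\<integral>x. q C x \<partial>P) * (real (length C) * - ln (a C)))"
    unfolding cost_def eta_def by (intro sum.cong refl) (simp add: a_def)
  also have "\<dots> = (\<Sum>C\<in>cycles k. \<integral>x. q C x * (real (length C) * - ln (a C)) \<partial>P)"
    by simp
  also have "\<dots> = (\<integral>x. ?h x \<partial>P)"
    using q_int by (intro Bochner_Integration.integral_sum[symmetric] integrable_mult_left) auto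
  also have "\<dots> \<le> (\<integral>x. ?g x \<partial>P)"
  proof (rule integral_mono_AE[OF _ g_int])
    show "integrable P ?h"
      using q_int by (intro Bochner_Integration.integrable_sum integrable_mult_left) auto
    show "AE x in P. ?h x \<le> ?g x"
      unfolding AE_measure_pmf_iff
    proof
      fix x assume x: "x \<in> set_pmf P"
      have "?h x \<le> (\<Sum>C\<in>cycles k. real (length C) * q C x * ?g x)"
      proof (rule sum_mono)
        fix C assume C: "C \<in> cycles k"
        show "q C x * (real (length C) * - ln (a C)) \<le> real (length C) * q C x * ?g x"
        proof (cases "?N x C = 0")
          case False
          have "pmf P x \<le> a C" by (rule key[OF x C False])
          then have "- ln (a C) \<le> ?g x" using pmf_positive[OF x] by simp
          then have "real (length C) * q C x * - ln (a C) \<le> real (length C) * q C x * ?g x"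
            using q0[OF x] by (intro mult_left_mono) auto
          then show ?thesis by (simp add: mult_ac)
        qed (simp add: q_def)
      qed
      also have "\<dots> = ?g x" unfolding sum_distrib_right[symmetric] q_sum[OF x] by simp
      finally show "?h x \<le> ?g x" .
    qed
  qed
  also have "\<dots> \<le> r" by (rule g_le)
  finally show ?thesis using feas by blast
qed

subsection \<open>Measures of finite total entropy\<close>

lemma map_shift_upto: "map (shift x) [i..j] = map x [i + 1..j + 1]"
  by (rule nth_equalityI) (simp_all add: shift_def ac_simps)

text \<open>Shifting one step at a time moves the window to the left. The case
  \<open>j = 2 * n\<close> gives the centred windows, so the entropy bounds for the marginals on
  \<open>0..j\<close> apply to them.\<close>

lemma distr_window:
  assumes "translation_invariant_prob \<mu>"
  shows "distr \<mu> (count_space UNIV) (\<lambda>x. map x [- int n..int j - int n]) = marg j \<mu>"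
proof (induction n)
  case 0
  then show ?case by (simp add: marg_def)
next
  case (Suc n)
  have sets: "sets \<mu> = sets Omega" and inv: "distr \<mu> Omega shift = \<mu>"
    using assms by (simp_all add: translation_invariant_prob_def)
  have "distr \<mu> (count_space UNIV) (\<lambda>x. map x [- int (Suc n)..int j - int (Suc n)])
      = distr (distr \<mu> Omega shift) (count_space UNIV) (\<lambda>x. map x [- int (Suc n)..int j - int (Suc n)])"
    unfolding inv ..
  also have "\<dots> = distr \<mu> (count_space UNIV) (\<lambda>x. map (shift x) [- int (Suc n)..int j - int (Suc n)])"
    using measurable_shift measurable_cong_sets[OF sets refl, of Omega]
    by (subst distr_distr[OF measurable_map]) (simp_all add: comp_def)
  also have "\<dots> = marg j \<mu>"
    using Suc.IH unfolding map_shift_upto by simp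
  finally show ?case .
qed

lemma measure_singleton_shift:
  assumes "translation_invariant_prob \<mu>"
  shows "measure \<mu> {shift x} = measure \<mu> {x}"
proof -
  have sets: "sets \<mu> = sets Omega" and inv: "distr \<mu> Omega shift = \<mu>"
    using assms by (simp_all add: translation_invariant_prob_def)
  have sp: "space \<mu> = UNIV" using sets_eq_imp_space_eq[OF sets] by simp
  have "translate (- 1) (shift y) = y" for y by (simp add: shift_eq_translate)
  then have "shift -` {shift x} \<inter> space \<mu> = {x}" unfolding sp by auto (metis)
  moreover have "measure (distr \<mu> Omega shift) {shift x} = measure \<mu> (shift -` {shift x} \<inter> space \<mu>)"
    using measurable_shift measurable_cong_sets[OF sets refl, of Omega] sets_singleton
    by (intro measure_distr) auto
  ultimately show ?thesis unfolding inv by simp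
qed

text \<open>Lower semicontinuity of \<open>info\<close>. The delicate value is \<open>t = 0\<close>:
  a finite supremum \<open>s\<close> keeps every \<open>f n\<close>, hence the limit, above
  \<open>exp (- s)\<close>.\<close>

lemma info_le_SUP:
  assumes "f \<longlonglongrightarrow> t" shows "info t \<le> (SUP n. info (f n))"
proof (cases "(SUP n. info (f n)) = \<infinity>")
  case False
  then obtain s where s: "(SUP n. info (f n)) = ennreal s" "0 \<le> s"
    by (cases "SUP n. info (f n)") auto
  have "exp (- s) \<le> f n" for n
  proof -
    have "info (f n) \<le> ennreal s" unfolding s(1)[symmetric] by (rule SUP_upper) simp
    then have pos: "0 < f n" and "ennreal (- ln (f n)) \<le> ennreal s"
      by (auto simp: info_def top_unique split: if_splits)
    then have "- s \<le> ln (f n)" using s(2) by (simp add: ennreal_le_iff)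
    then show ?thesis using pos by (simp add: ln_ge_iff)
  qed
  then have t: "exp (- s) \<le> t" using assms by (intro LIMSEQ_le_const) auto
  then have pos: "0 < t" using exp_gt_zero by (rule order.strict_trans2[rotated])
  with t have "- ln t \<le> s" using ln_ge_iff[OF pos, of "- s"] by simp
  then show ?thesis using pos unfolding s(1) by (auto simp: info_def intro: ennreal_leI)
next
  case True
  show ?thesis unfolding True by simp
qed

text \<open>The information of the windows \<open>- n..n\<close> increases to the information of the point;
  a bound on its mean forces almost every point to have positive mass.\<close>

lemma finite_entropy_atomic:
  assumes inv: "translation_invariant_prob \<mu>" and bound: "\<And>j. marg_entropy j \<mu> \<le> r"
  obtains P where "\<mu> = distr (measure_pmf P) Omega id" "\<And>x. pmf P x = measure \<mu> {x}"
    "(\<integral>\<^sup>+x. ennreal (- ln (pmf P x)) \<partial>P) \<le> ennreal r"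
proof -
  have sets: "sets \<mu> = sets Omega" and "prob_space \<mu>"
    using inv by (simp_all add: translation_invariant_prob_def)
  interpret prob_space \<mu> by fact
  have sp: "space \<mu> = UNIV" using sets_eq_imp_space_eq[OF sets] by simp
  have sing: "{x} \<in> events" for x unfolding sets by (rule sets_singleton)
  define win :: "nat \<Rightarrow> (int \<Rightarrow> bool) \<Rightarrow> bool list" where "win n x = map x [- int n..int n]" for n x
  define f where "f n x = info (measure \<mu> {y. win n y = win n x})" for n x
  have win_meas: "win n \<in> Omega \<rightarrow>\<^sub>M count_space UNIV" for n
    unfolding win_def by (rule measurable_map)
  have win_sets: "{y. win n y = w} \<in> events" for n w
    unfolding win_def sets by (rule sets_map_eq)
  have win_mono: "{y. win (Suc n) y = win (Suc n) x} \<subseteq> {y. win n y = win n x}" for n x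
    by (auto simp: win_def map_eq_conv)
  have f_meas: "f n \<in> borel_measurable Omega" for n
    unfolding f_def
    by (rule measurable_compose[OF win_meas, where g = "\<lambda>w. info (measure \<mu> {y. win n y = w})"]) simp
  have f_meas': "f n \<in> borel_measurable \<mu>" for n
    using f_meas[of n] unfolding measurable_cong_sets[OF sets refl] .
  have f_int: "(\<integral>\<^sup>+x. f n x \<partial>\<mu>) \<le> ennreal r" for n
  proof -
    have "win n \<in> \<mu> \<rightarrow>\<^sub>M count_space UNIV"
      using win_meas[of n] unfolding measurable_cong_sets[OF sets refl] .
    moreover have "win n x \<in> {w. length w = Suc (2 * n)}" for x by (simp add: win_def)
    ultimately have "(\<integral>\<^sup>+x. f n x \<partial>\<mu>) = ennreal (\<Sum>w\<in>{w. length w = Suc (2 * n)}.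
        eta (measure (distr \<mu> (count_space UNIV) (win n)) {w}))"
      using nn_integral_info_distr[OF \<open>prob_space \<mu>\<close> _ finite_bool_lists, of "win n"]
      unfolding f_def sp by simp
    also have "distr \<mu> (count_space UNIV) (win n) = marg (2 * n) \<mu>"
      using distr_window[OF inv, of n "2 * n"] unfolding win_def by simp
    also have "ennreal (\<Sum>w\<in>{w. length w = Suc (2 * n)}. eta (measure (marg (2 * n) \<mu>) {w})) \<le> ennreal r"
      unfolding marg_entropy_eq[symmetric] by (rule ennreal_leI[OF bound])
    finally show ?thesis .
  qed
  define G where "G x = (SUP n. f n x)" for x
  have G_meas: "G \<in> borel_measurable Omega"
    unfolding G_def by (rule borel_measurable_SUP) (simp_all add: f_meas)
  have G_meas': "G \<in> borel_measurable \<mu>"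
    using G_meas unfolding measurable_cong_sets[OF sets refl] .
  have "incseq f"
    unfolding f_def
    by (intro incseq_SucI le_funI info_antimono finite_measure_mono win_mono win_sets)
  then have "(\<integral>\<^sup>+x. G x \<partial>\<mu>) = (SUP n. \<integral>\<^sup>+x. f n x \<partial>\<mu>)"
    unfolding G_def by (rule nn_integral_monotone_convergence_SUP[OF _ f_meas'])
  also have "\<dots> \<le> ennreal r" by (rule SUP_least) (rule f_int)
  finally have G_int: "(\<integral>\<^sup>+x. G x \<partial>\<mu>) \<le> ennreal r" .
  have le_G: "info (measure \<mu> {x}) \<le> G x" for x
  proof -
    have "(\<Inter>n. {y. win n y = win n x}) = {x}"
      unfolding win_def by (rule singleton_eq_INT_windows[symmetric])
    moreover have "(\<lambda>n. measure \<mu> {y. win n y = win n x}) \<longlonglongrightarrow> measure \<mu> (\<Inter>n. {y. win n y = win n x})"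
      using win_sets by (intro finite_Lim_measure_decseq decseq_SucI win_mono) blast
    ultimately show ?thesis
      unfolding G_def f_def by (intro info_le_SUP) simp
  qed
  have "AE x in \<mu>. G x \<noteq> \<infinity>"
    by (rule nn_integral_PInf_AE[OF G_meas']) (use G_int in \<open>auto simp: top_unique\<close>)
  then have AE_pos: "AE x in \<mu>. measure \<mu> {x} \<noteq> 0"
  proof (rule AE_mp, intro AE_I2 impI notI)
    fix x assume "G x \<noteq> \<infinity>" "measure \<mu> {x} = 0"
    then show False using le_G[of x] by (simp add: info_def top_unique)
  qed
  define A where "A = {x. measure \<mu> {x} \<noteq> 0}"
  have A_count: "countable A" unfolding A_def by (rule countable_support)
  have A_sets: "B \<inter> A \<in> events" for B
    using A_count by (intro sets.countable[OF sing]) auto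
  have A_sum: "emeasure \<mu> (B \<inter> A) = (\<integral>\<^sup>+x. ennreal (measure \<mu> {x}) \<partial>count_space (B \<inter> A))" for B
    using A_count by (subst emeasure_countable_singleton) (auto simp: sing emeasure_eq_measure)
  have A_full: "emeasure \<mu> (B \<inter> A) = emeasure \<mu> B" if "B \<in> events" for B
    by (rule emeasure_eq_AE[OF _ A_sets that]) (use AE_pos in \<open>auto simp: A_def\<close>)
  \<comment> \<open>The atoms exhaust the mass, which is the normalisation that a pmf
    requires.\<close>
  have A1: "(\<integral>\<^sup>+x. ennreal (measure \<mu> {x}) \<partial>count_space UNIV) = 1"
  proof -
    have "(\<integral>\<^sup>+x. ennreal (measure \<mu> {x}) \<partial>count_space UNIV)
        = (\<integral>\<^sup>+x. ennreal (measure \<mu> {x}) \<partial>count_space A)"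
      unfolding nn_integral_count_space_indicator[of A]
      by (rule nn_integral_count_space_eq) (auto simp: A_def)
    also have "\<dots> = emeasure \<mu> UNIV" using A_sum[of UNIV] A_full[of UNIV] sets.top[of \<mu>] sp by simp
    finally show ?thesis using emeasure_space_1 sp by simp
  qed
  define P where "P = embed_pmf (\<lambda>x. measure \<mu> {x})"
  have pmf_P: "pmf P x = measure \<mu> {x}" for x
    unfolding P_def by (rule pmf_embed_pmf) (simp_all add: A1)
  have set_P: "set_pmf P = A" by (auto simp: set_pmf_iff pmf_P A_def)
  have \<mu>_eq: "\<mu> = distr (measure_pmf P) Omega id"
  proof (rule measure_eqI)
    show "sets \<mu> = sets (distr (measure_pmf P) Omega id)" by (simp add: sets)
    fix B assume B: "B \<in> events"
    have "emeasure (measure_pmf P) B = emeasure (measure_pmf P) (B \<inter> A)"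
      by (rule emeasure_eq_AE) (auto simp: AE_measure_pmf_iff set_P)
    also have "\<dots> = (\<integral>\<^sup>+x. emeasure (measure_pmf P) {x} \<partial>count_space (B \<inter> A))"
      using A_count by (intro emeasure_countable_singleton) auto
    also have "\<dots> = emeasure \<mu> (B \<inter> A)"
      unfolding A_sum by (simp add: emeasure_pmf_single pmf_P)
    finally show "emeasure \<mu> B = emeasure (distr (measure_pmf P) Omega id) B"
      using A_full[OF B] B sets by (subst emeasure_distr) auto
  qed
  have "(\<integral>\<^sup>+x. ennreal (- ln (pmf P x)) \<partial>P) \<le> (\<integral>\<^sup>+x. G x \<partial>P)"
  proof (rule nn_integral_mono_AE, unfold AE_measure_pmf_iff, rule ballI)
    fix x assume "x \<in> set_pmf P"
    then have "ennreal (- ln (pmf P x)) = info (pmf P x)" by (simp add: info_def set_pmf_iff)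
    also have "\<dots> \<le> G x" unfolding pmf_P by (rule le_G)
    finally show "ennreal (- ln (pmf P x)) \<le> G x" .
  qed
  also have "\<dots> = (\<integral>\<^sup>+x. G x \<partial>\<mu>)"
    using nn_integral_distr[of id "measure_pmf P" Omega G] G_meas'
    unfolding \<mu>_eq[symmetric] by simp
  finally have "(\<integral>\<^sup>+x. ennreal (- ln (pmf P x)) \<partial>P) \<le> ennreal r" using G_int by (rule order_trans)
  with \<mu>_eq pmf_P show thesis by (rule that)
qed

section \<open>Comparison with every competitor, and the sparse representation\<close>

lemma ex_feasible_cost_le:
  assumes inv: "translation_invariant_prob \<mu>" and marg: "marg k \<mu> = measure_pmf p"
    and bound: "\<And>j. marg_entropy j \<mu> \<le> r"
  shows "\<exists>a\<in>feasible k (pmf p). cost k a \<le> r"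
proof -
  obtain P where P: "\<mu> = distr (measure_pmf P) Omega id" "\<And>x. pmf P x = measure \<mu> {x}"
    "(\<integral>\<^sup>+x. ennreal (- ln (pmf P x)) \<partial>P) \<le> ennreal r"
    using finite_entropy_atomic[OF inv bound] by blast
  have "measure_pmf (map_pmf (word k) P) = measure_pmf p"
    using marg unfolding P(1) marg_distr_Omega .
  then have "map_pmf (word k) P = p" by (simp add: measure_pmf_inject)
  moreover have "pmf P (shift x) = pmf P x" for x
    unfolding P(2) by (rule measure_singleton_shift[OF inv])
  moreover have "0 \<le> r"
    using marg_entropy_nonneg[of \<mu> 0] bound[of 0] inv
    by (auto simp: translation_invariant_prob_def)
  ultimately show ?thesis using ex_feasible_cost_le_pmf[OF _ _ P(3)] by blast
qed

lemma cost_le_total_entropy: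
  assumes inv: "translation_invariant_prob \<mu>" and marg: "marg k \<mu> = measure_pmf p"
    and min: "\<And>b. b \<in> feasible k (pmf p) \<Longrightarrow> cost k a \<le> cost k b"
  shows "ereal (cost k a) \<le> total_entropy \<mu>"
proof -
  have T: "total_entropy \<mu> = (SUP j. ereal (marg_entropy j \<mu>))"
    using inv by (intro total_entropy_eq_SUP) (simp_all add: translation_invariant_prob_def)
  have le: "ereal (marg_entropy j \<mu>) \<le> total_entropy \<mu>" for j
    unfolding T by (rule SUP_upper) simp
  show ?thesis
  proof (cases "total_entropy \<mu>")
    case (real r)
    then have "marg_entropy j \<mu> \<le> r" for j using le[of j] by simp
    from ex_feasible_cost_le[OF inv marg this] min real show ?thesis
      by (auto intro: order_trans)
  \<comment> \<open>The value \<open>\<infinity>\<close> is trivial, and \<open>-\<infinity>\<close>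
    is excluded by a real marginal entropy below the limit.\<close>
  qed (use le[of 0] in auto)
qed

text \<open>A support with fewer than \<open>n + 1\<close> elements is padded by \<open>C0\<close>
  with weight \<open>0\<close>. The indexing is fixed before \<open>g\<close>, so that it serves the
  normalisation and all events at once.\<close>

lemma sum_sparse_reindex:
  fixes a :: "'c \<Rightarrow> real"
  assumes "finite S" "card S \<le> Suc n" "C0 \<in> K" "S \<subseteq> K"
    and a0: "\<And>C. 0 \<le> a C"
  obtains c C where "\<And>i. 0 \<le> c i" "\<And>i::nat. C i \<in> K"
    "\<And>g :: 'c \<Rightarrow> real. (\<Sum>i\<le>n. c i * g (C i)) = (\<Sum>C\<in>S. a C * g C)"
proof -
  obtain h where h: "bij_betw h {0..<card S} S"
    using ex_bij_betw_nat_finite[OF assms(1)] by blast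
  define C where "C i = (if i < card S then h i else C0)" for i
  define c where "c i = (if i < card S then a (h i) else 0)" for i
  show thesis
  proof (rule that[of c C])
    show "0 \<le> c i" for i using a0 by (simp add: c_def)
    show "C i \<in> K" for i
      using bij_betwE[OF h] assms(3,4) by (auto simp: C_def)
    fix g :: "'c \<Rightarrow> real"
    have "(\<Sum>i\<le>n. c i * g (C i)) = (\<Sum>i\<in>{0..<card S}. a (h i) * g (h i))"
      using assms(2) by (intro sum.mono_neutral_cong_right) (auto simp: c_def C_def)
    also have "\<dots> = (\<Sum>C\<in>S. a C * g C)" by (rule sum.reindex_bij_betw[OF h])
    finally show "(\<Sum>i\<le>n. c i * g (C i)) = (\<Sum>C\<in>S. a C * g C)" .
  qed
qed

lemma mixture_measure_sparse:
  assumes a: "a \<in> feasible k (pmf p)" "set_pmf p \<subseteq> edges k"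
    and card: "card {C. a C \<noteq> 0} \<le> Suc n"
  shows "\<exists>(c :: nat \<Rightarrow> real) C. (\<forall>i\<le>n. 0 \<le> c i \<and> debruijn_cycle k (C i)) \<and> (\<Sum>i\<le>n. c i) = 1 \<and>
    (\<forall>A\<in>sets Omega. measure (mixture_measure a) A = (\<Sum>i\<le>n. c i * measure (nu_cycle (C i)) A))"
proof -
  let ?S = "{C. a C \<noteq> 0}"
  have sum_S: "(\<Sum>C\<in>?S. real (length C) * a C * g C) = (\<Sum>C\<in>cycles k. real (length C) * a C * g C)" for g
    by (rule sum.mono_neutral_left) (use finite_support(2)[OF a(1)] in auto)
  have "cycles k \<noteq> {}" using feasible_sum_length[OF a] by auto
  then obtain C0 where "C0 \<in> cycles k" by blast
  moreover have "0 \<le> real (length C) * a C" for C using a(1) by (simp add: feasible_def)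
  ultimately obtain c C where c: "\<And>i. 0 \<le> c i" "\<And>i::nat. C i \<in> cycles k"
    "\<And>g. (\<Sum>i\<le>n. c i * g (C i)) = (\<Sum>C\<in>?S. real (length C) * a C * g C)"
    using sum_sparse_reindex[OF finite_support(1)[OF a(1)] card _ finite_support(2)[OF a(1)],
      of C0 "\<lambda>C. real (length C) * a C"] by blast
  have "(\<Sum>i\<le>n. c i) = 1"
    using c(3)[of "\<lambda>_. 1"] sum_S[of "\<lambda>_. 1"] feasible_sum_length[OF a] by simp
  moreover have "measure (mixture_measure a) A = (\<Sum>i\<le>n. c i * measure (nu_cycle (C i)) A)"
    if "A \<in> sets Omega" for A
    unfolding mixture_measure_def measure_distr_Omega[OF that] measure_mixture[OF a] sum_S[symmetric]
      c(3)[of "\<lambda>C. measure (cycle_pmf C) A", symmetric] nu_cycle_def cycle_pmf_def[symmetric] ..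
  moreover have "debruijn_cycle k (C i)" for i using c(2)[of i] by (simp add: cycles_def)
  ultimately show ?thesis using c(1) by (intro exI[of _ c] exI[of _ C]) blast
qed

theorem theorem5p2:
  fixes k :: nat and \<mu>k :: "bool list pmf"
  assumes "k \<ge> 1" and "LTI k \<mu>k"
  shows "\<exists>\<mu>hat. translation_invariant_prob \<mu>hat \<and> marg k \<mu>hat = measure_pmf \<mu>k \<and>
           (\<forall>\<mu>. translation_invariant_prob \<mu> \<and> marg k \<mu> = measure_pmf \<mu>k
                  \<longrightarrow> total_entropy \<mu>hat \<le> total_entropy \<mu>) \<and>
           (\<exists>(c :: nat \<Rightarrow> real) (C :: nat \<Rightarrow> bool list list).
              (\<forall>i\<le>2^k. c i \<ge> 0 \<and> debruijn_cycle k (C i)) \<and>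
              (\<Sum>i\<le>2^k. c i) = 1 \<and>
              (\<forall>A\<in>sets Omega. measure \<mu>hat A = (\<Sum>i\<le>2^k. c i * measure (nu_cycle (C i)) A)))"
proof -
  have sub: "set_pmf \<mu>k \<subseteq> edges k" using assms(2) by (simp add: LTI_def edges_def)
  obtain a where a: "a \<in> feasible k (pmf \<mu>k)" and card: "card {C. a C \<noteq> 0} \<le> 2 ^ k + 1"
    and min: "\<And>b. b \<in> feasible k (pmf \<mu>k) \<Longrightarrow> cost k a \<le> cost k b"
    using ex_sparse_minimizer[OF feasible_nonempty[OF assms(2)]] by metis
  have "total_entropy (mixture_measure a) \<le> total_entropy \<mu>"
    if "translation_invariant_prob \<mu> \<and> marg k \<mu> = measure_pmf \<mu>k" for \<mu>
    using total_entropy_mixture_le[OF a sub] cost_le_total_entropy[of \<mu> k \<mu>k a] that min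
    by (meson order_trans)
  moreover have "card {C. a C \<noteq> 0} \<le> Suc (2 ^ k)" using card by simp
  ultimately show ?thesis
    using translation_invariant_mixture[OF a sub] marg_mixture[OF a sub]
      mixture_measure_sparse[OF a sub, of "2 ^ k"]
    by (intro exI[of _ "mixture_measure a"] conjI allI impI)
qed

end
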